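(* Let $z\in\{1,2\}$ and consider the dependent collective risk model $(N,\boldsymbol{Y}^{[N]})$ built on the Gaussian-copula conditional collective risk model with correlation structure $z$, as described in the context. Then the joint density function of the discrete margin $N$ and the continuous margins $\boldsymbol{Y}^{[N]}$ is $$h(n,\boldsymbol{y}^{[n]})=\begin{cases}p\,f_{\boldsymbol{Y}^{[n]}}(\boldsymbol{y}^{[n]})\left(\Phi\left(\dfrac{\Phi^{-1}(F_1^+(n))-\mu_{[n,z]}}{\sigma_{[n,z]}}\right)-\Phi\left(\dfrac{\Phi^{-1}(F_1^+(n-1))-\mu_{[n,z]}}{\sigma_{[n,z]}}\right)\right),&n\in\{1,2,\dots\},\ \boldsymbol{y}^{[n]}\in\mathbb{R}^n,\\[3mm]1-p,&n=0,\end{cases}$$ where, for $\boldsymbol{y}^{[n]}=(y_1,\dots,y_n)$, $$\mu_{[n,z]}=\left(\rho_1\mathbf{1}_n^{\mathrm T}\right)\left(\boldsymbol{\Sigma}_{\rho_2}^{[n,z]}\right)^{-1}\left(\Phi^{-1}(F_2(y_1)),\dots,\Phi^{-1}(F_2(y_n))\right)^{\mathrm T},$$ $$\sigma_{[n,z]}=\sqrt{1-\left(\rho_1\mathbf{1}_n^{\mathrm T}\right)\left(\boldsymbol{\Sigma}_{\rho_2}^{[n,z]}\right)^{-1}\left(\rho_1\mathbf{1}_n\right)},\qquad f_{\boldsymbol{Y}^{[n]}}(\boldsymbol{y}^{[n]})=c_{\boldsymbol{\Sigma}_{\rho_2}^{[n,z]}}\left(F_2(y_1),\dots,F_2(y_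n)\right)\prod_{i=1}^nf_2(y_i).$$
   Context: Matrices: for a positive integer $k$, $\boldsymbol{\Sigma}_{\rho_2}^{[k,1]}$ is the $k\times k$ matrix with diagonal entries $1$ and off-diagonal entries $\rho_2$; $\boldsymbol{\Sigma}_{\rho_2}^{[k,2]}$ is the $k\times k$ matrix with $(i,j)$ entry $\rho_2^{|i-j|}$ (diagonal entries $1$). For $z\in\{1,2\}$, $$\boldsymbol{\Sigma}_{\rho_1,\rho_2}^{[k,z]}=\begin{pmatrix}1&\rho_1\mathbf{1}_k^{\mathrm T}\\ \rho_1\mathbf{1}_k&\boldsymbol{\Sigma}_{\rho_2}^{[k,z]}\end{pmatrix},$$ with $\mathbf{1}_k$ the column vector of ones of length $k$. Gaussian copula: $\Phi$ is the standard normal distribution function, with $\Phi^{-1}(0)=-\infty$, $\Phi^{-1}(1)=+\infty$, $\Phi(-\infty)=0$, $\Phi(+\infty)=1$. For a $d\times d$ positive definite correlation matrix $\boldsymbol{\Sigma}$, $C_{\boldsymbol{\Sigma}}(u_1,\dots,u_d)=P(Z_1\le\Phi^{-1}(u_1),\dots,Z_d\le\Phi^{-1}(u_d))$ with $(Z_1,\dots,Z_d)\sim\mathrm{MVN}(\boldsymbol{0},\boldsymbol{\Sigma})$, and $c_{\boldsymbol{\Sigma}}$ is its density on $(0,1)^d$. Conditional model: $N^+$ is a non-degenerate positive-integer-valued random variable with distribution function $F_1^+$; $F_2$ is a continuous distribution function on $[0,\infty)$ with probability density function $f_2$. The parameters satisfy $\rho_1,\rho_2\in(-1,1)$, with $\rho_1^2<\rho_2<1$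 if $z=1$, and the matrices $\boldsymbol{\Sigma}_{\rho_2}^{[k,z]}$ and $\boldsymbol{\Sigma}_{\rho_1,\rho_2}^{[k,z]}$ are assumed positive definite for every positive integer $k$. For every positive integer $k$, $$P(N^+\le n,\,Y_1\le y_1,\dots,Y_k\le y_k)=C_{\boldsymbol{\Sigma}_{\rho_1,\rho_2}^{[k,z]}}\left(F_1^+(n),F_2(y_1),\dots,F_2(y_k)\right).$$ Dependent collective risk model: $R$ is a Bernoulli random variable with success probability $p$, independent of $(N^+,Y_1,\dots,Y_k)$ for every $k>0$. Set $N=N^+$ if $R=1$ and $N=0$ if $R=0$; and $(N,\boldsymbol{Y}^{[N]})=(N,Y_1,\dots,Y_N)$ if $N\ge1$, $(N,\boldsymbol{Y}^{[N]})=0$ if $N=0$. Meaning of density: $P(N=0)=h(0)$, and for each $n\ge1$ and Borel $B\subseteq\mathbb{R}^n$, $P(N=n,(Y_1,\dots,Y_n)\in B)=\int_Bh(n,\boldsymbol{y}^{[n]})\,d\boldsymbol{y}^{[n]}$. The density formula is read as $0$ at points where some $F_2(y_i)\in\{0,1\}$. *)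

theory Defs
  imports
    "HOL-Probability.Probability"
    "Jordan_Normal_Form.Determinant"
    "Jordan_Normal_Form.Gauss_Jordan_Elimination"
begin

(* Both libraries have constants called vec, mat and det; qualified names are used where
   the Jordan_Normal_Form ones are meant.  Vectors and matrices are indexed from 0, so
   row and column 0 of a bordered matrix belong to the claim count. *)

section \<open>Standard normal distribution function and its inverse\<close>

definition std_normal_cdf :: "real \<Rightarrow> real" where
  "std_normal_cdf = cdf std_normal_distribution"

definition std_normal_cdf_ext :: "ereal \<Rightarrow> real" where
  "std_normal_cdf_ext x =
     (if x = -\<infinity> then 0 else if x = \<infinity> then 1 else std_normal_cdf (real_of_ereal x))"

definition std_normal_quantile :: "real \<Rightarrow> ereal" where
  "std_normal_quantile u =
     (if u \<le> 0 then -\<infinity> else if u \<ge> 1 then \<infinity> else ereal (THE x. std_normal_cdf x = u))"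

section \<open>Correlation matrices\<close>

definition exchangeable_corr :: "real \<Rightarrow> nat \<Rightarrow> real Matrix.mat" where
  "exchangeable_corr \<rho> k = Matrix.mat k k (\<lambda>(i, j). if i = j then 1 else \<rho>)"

definition ar1_corr :: "real \<Rightarrow> nat \<Rightarrow> real Matrix.mat" where
  "ar1_corr \<rho> k = Matrix.mat k k (\<lambda>(i, j). \<rho> ^ nat \<bar>int i - int j\<bar>)"

definition severity_corr :: "nat \<Rightarrow> real \<Rightarrow> nat \<Rightarrow> real Matrix.mat" where
  "severity_corr z \<rho>2 k = (if z = 1 then exchangeable_corr \<rho>2 k else ar1_corr \<rho>2 k)"

abbreviation ones_vec :: "nat \<Rightarrow> real Matrix.vec" where
  "ones_vec k \<equiv> Matrix.vec k (\<lambda>_. 1)"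

definition joint_corr :: "nat \<Rightarrow> real \<Rightarrow> real \<Rightarrow> nat \<Rightarrow> real Matrix.mat" where
  "joint_corr z \<rho>1 \<rho>2 k =
     four_block_mat
       (1\<^sub>m 1)                             (Matrix.mat 1 k (\<lambda>_. \<rho>1))
       (Matrix.mat k 1 (\<lambda>_. \<rho>1))      (severity_corr z \<rho>2 k)"

definition positive_definite_mat :: "nat \<Rightarrow> real Matrix.mat \<Rightarrow> bool" where
  "positive_definite_mat d A \<longleftrightarrow>
     A \<in> carrier_mat d d \<and> transpose_mat A = A \<and>
     (\<forall>v \<in> carrier_vec d. v \<noteq> 0\<^sub>v d \<longrightarrow> scalar_prod v (A *\<^sub>v v) > 0)"

(* Only meaningful for invertible matrices. *)
definition inverse_mat :: "real Matrix.mat \<Rightarrow> real Matrix.mat" where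
  "inverse_mat A = the (mat_inverse A)"

section \<open>Centred multivariate normal law and Gaussian copula\<close>

(* A point of R^d is an extensional function on {..<d}. *)
abbreviation lborel_pow :: "nat \<Rightarrow> (nat \<Rightarrow> real) measure" where
  "lborel_pow d \<equiv> PiM {..<d} (\<lambda>_. lborel)"

definition mvn_density :: "nat \<Rightarrow> real Matrix.mat \<Rightarrow> (nat \<Rightarrow> real) \<Rightarrow> real" where
  "mvn_density d \<Sigma> x =
     exp (- (scalar_prod (Matrix.vec d x) (inverse_mat \<Sigma> *\<^sub>v Matrix.vec d x)) / 2)
       / sqrt ((2 * pi) ^ d * Determinant.det \<Sigma>)"

(* The law MVN(0, Sigma), for positive definite Sigma. *)
definition mvn :: "nat \<Rightarrow> real Matrix.mat \<Rightarrow> (nat \<Rightarrow> real) measure" where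
  "mvn d \<Sigma> = density (lborel_pow d) (\<lambda>x. ennreal (mvn_density d \<Sigma> x))"

definition gaussian_copula :: "nat \<Rightarrow> real Matrix.mat \<Rightarrow> (nat \<Rightarrow> real) \<Rightarrow> real" where
  "gaussian_copula d \<Sigma> u =
     measure (mvn d \<Sigma>)
       {x \<in> space (mvn d \<Sigma>). \<forall>i<d. ereal (x i) \<le> std_normal_quantile (u i)}"

abbreviation open_unit_cube :: "nat \<Rightarrow> (nat \<Rightarrow> real) set" where
  "open_unit_cube d \<equiv> PiE {..<d} (\<lambda>_. {0<..<1})"

(* c is a density on (0,1)^d of the distribution function C on [0,1]^d.  Values of c
   outside the open cube are irrelevant. *)
definition is_copula_density ::
  "nat \<Rightarrow> ((nat \<Rightarrow> real) \<Rightarrow> real) \<Rightarrow> ((nat \<Rightarrow> real) \<Rightarrow> real) \<Rightarrow> bool" where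
  "is_copula_density d C c \<longleftrightarrow>
     set_borel_measurable (lborel_pow d) (open_unit_cube d) c \<and>
     (\<forall>v \<in> open_unit_cube d. 0 \<le> c v) \<and>
     (\<forall>u \<in> PiE {..<d} (\<lambda>_. {0..1}).
        ennreal (C u) =
          (\<integral>\<^sup>+ v \<in> {v \<in> open_unit_cube d. \<forall>i<d. v i \<le> u i}. ennreal (c v) \<partial>lborel_pow d))"

section \<open>Severity distribution and the density of the collective risk model\<close>

(* F is a continuous distribution function of a law on [0, infinity) with
   probability density function f. *)
definition is_severity_distribution :: "(real \<Rightarrow> real) \<Rightarrow> (real \<Rightarrow> real) \<Rightarrow> bool" where
  "is_severity_distribution F f \<longleftrightarrow>
     f \<in> borel_measurable borel \<and> (\<forall>y. 0 \<le> f y) \<and>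
     prob_space (density lborel (\<lambda>y. ennreal (f y))) \<and>
     F = cdf (density lborel (\<lambda>y. ennreal (f y))) \<and>
     continuous_on UNIV F \<and> (\<forall>y<0. F y = 0)"

(* real_of_ereal loses nothing where it matters, namely if F2 (y i) is in (0,1) for all i < n. *)
definition cond_mean ::
  "nat \<Rightarrow> real \<Rightarrow> real \<Rightarrow> (real \<Rightarrow> real) \<Rightarrow> nat \<Rightarrow> (nat \<Rightarrow> real) \<Rightarrow> real" where
  "cond_mean z \<rho>1 \<rho>2 F2 n y =
     scalar_prod (\<rho>1 \<cdot>\<^sub>v ones_vec n)
       (inverse_mat (severity_corr z \<rho>2 n)
          *\<^sub>v Matrix.vec n (\<lambda>i. real_of_ereal (std_normal_quantile (F2 (y i)))))"

definition cond_sd :: "nat \<Rightarrow> real \<Rightarrow> real \<Rightarrow> nat \<Rightarrow> real" where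
  "cond_sd z \<rho>1 \<rho>2 n =
     sqrt (1 - scalar_prod (\<rho>1 \<cdot>\<^sub>v ones_vec n)
                 (inverse_mat (severity_corr z \<rho>2 n) *\<^sub>v (\<rho>1 \<cdot>\<^sub>v ones_vec n)))"

definition severity_density ::
  "(nat \<Rightarrow> (nat \<Rightarrow> real) \<Rightarrow> real) \<Rightarrow> (real \<Rightarrow> real) \<Rightarrow> (real \<Rightarrow> real)
     \<Rightarrow> nat \<Rightarrow> (nat \<Rightarrow> real) \<Rightarrow> real" where
  "severity_density c F2 f2 n y = c n (\<lambda>i\<in>{..<n}. F2 (y i)) * (\<Prod>i<n. f2 (y i))"

(* F1 is the distribution function of the positive claim count and c n a density of the
   copula of the first n severities. *)
definition risk_density ::
  "nat \<Rightarrow> real \<Rightarrow> real \<Rightarrow> real \<Rightarrow> (real \<Rightarrow> real) \<Rightarrow> (real \<Rightarrow> real) \<Rightarrow> (real \<Rightarrow> real)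
     \<Rightarrow> (nat \<Rightarrow> (nat \<Rightarrow> real) \<Rightarrow> real) \<Rightarrow> nat \<Rightarrow> (nat \<Rightarrow> real) \<Rightarrow> real" where
  "risk_density z \<rho>1 \<rho>2 p F1 F2 f2 c n y =
     (if n = 0 then 1 - p
      else if \<exists>i<n. F2 (y i) \<in> {0, 1} then 0
      else p * severity_density c F2 f2 n y *
        (std_normal_cdf_ext
           ((std_normal_quantile (F1 (real n)) - ereal (cond_mean z \<rho>1 \<rho>2 F2 n y))
              / ereal (cond_sd z \<rho>1 \<rho>2 n))
         - std_normal_cdf_ext
           ((std_normal_quantile (F1 (real n - 1)) - ereal (cond_mean z \<rho>1 \<rho>2 F2 n y))
              / ereal (cond_sd z \<rho>1 \<rho>2 n))))"

(* The library's indep_var requires both variables to take values in the same type. *)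
definition indep_rvs ::
  "'a measure \<Rightarrow> 'b measure \<Rightarrow> ('a \<Rightarrow> 'b) \<Rightarrow> 'c measure \<Rightarrow> ('a \<Rightarrow> 'c) \<Rightarrow> bool" where
  "indep_rvs M S X T Z \<longleftrightarrow>
     X \<in> measurable M S \<and> Z \<in> measurable M T \<and>
     prob_space.indep_set M
       {X -` A \<inter> space M | A. A \<in> sets S} {Z -` B \<inter> space M | B. B \<in> sets T}"

(* h is a joint density of the random vector (N, Y 0, ..., Y (N - 1)) of random length,
   with respect to counting measure in N and Lebesgue measure in the severities. *)
definition is_joint_density ::
  "'a measure \<Rightarrow> ('a \<Rightarrow> nat) \<Rightarrow> (nat \<Rightarrow> 'a \<Rightarrow> real) \<Rightarrow> (nat \<Rightarrow> (nat \<Rightarrow> real) \<Rightarrow> real) \<Rightarrow> bool" where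
  "is_joint_density M N Y h \<longleftrightarrow>
     (\<forall>y. measure M {\<omega> \<in> space M. N \<omega> = 0} = h 0 y) \<and>
     (\<forall>n\<ge>1. h n \<in> borel_measurable (lborel_pow n) \<and>
        (\<forall>y \<in> space (lborel_pow n). 0 \<le> h n y) \<and>
        (\<forall>B \<in> sets (PiM {..<n} (\<lambda>_. borel)).
           emeasure M {\<omega> \<in> space M. N \<omega> = n \<and> (\<lambda>i\<in>{..<n}. Y i \<omega>) \<in> B}
             = (\<integral>\<^sup>+ y \<in> B. ennreal (h n y) \<partial>lborel_pow n)))"

end

theory Submission
  imports Defs
begin

text \<open>A bordered covariance matrix has a Schur complement, which splits the normal density into
  the density of the severity scores and a univariate normal density of the count score given the
  severity scores, with mean \<open>\<mu>\<close> and standard deviation \<open>\<sigma>\<close>. Integrating out the count score turns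
  the joint copula into an integral of \<open>\<Phi> ((\<Phi>\<^sup>-\<^sup>1 (F\<^sub>1 (n)) - \<mu>) / \<sigma>)\<close> against the law of the severity scores.
  The copula density is the density of that law after applying \<open>\<Phi>\<close> to every coordinate, and \<open>F\<^sub>2\<close>
  carries the severity law to the uniform law, so the integral can be rewritten on the severity
  scale. Differences in \<open>n\<close> give the law of the severities on \<open>N\<^sup>+ = n\<close>, first on lower orthants, which
  determine it; independence of \<open>R\<close> contributes the factor \<open>p\<close>.\<close>

text \<open>The copula density is known only through its integrals over boxes, and \<open>F2\<close>
  may be flat where \<open>f2\<close> vanishes, so no change of variables with a Jacobian is
  available. Everything is therefore an identity between image measures. The pivot is the uniform
  law on the open unit cube: the copula density is a density relative to it, and it is also the
  image under coordinatewise \<open>F2\<close> of the product law with marginal density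
  \<open>f2\<close>. Points where some \<open>F2 (y i)\<close> is 0 or 1 get no mass on this route,
  in agreement with the value 0 of \<open>risk_density\<close> there. The normal laws are given by
  their density formula, so even their total mass has to be computed; peeling off coordinate 0
  serves both this and the conditioning on the severities. Orthant bounds are extended reals because
  quantiles at the levels 0 and 1 do occur, for instance at \<open>F1 0 = 0\<close>.\<close>

unbundle no vec_syntax

section \<open>Bordered positive definite matrices\<close>

text \<open>The corner is a parameter although the model only has corner 1: in this generality every
  symmetric matrix of positive size is bordered, as inductions on the dimension require.\<close>

definition bordered_mat :: "real \<Rightarrow> real Matrix.vec \<Rightarrow> real Matrix.mat \<Rightarrow> real Matrix.mat" where
  "bordered_mat a b S =
     four_block_mat (Matrix.mat 1 1 (\<lambda>_. a)) (Matrix.mat 1 (dim_vec b) (\<lambda>(i, j). b $ j))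
       (Matrix.mat (dim_vec b) 1 (\<lambda>(i, j). b $ i)) S"

lemma bordered_mat_carrier [simp]:
  assumes "b \<in> carrier_vec k" "S \<in> carrier_mat k k"
  shows "bordered_mat a b S \<in> carrier_mat (Suc k) (Suc k)"
  using assms by (auto simp: bordered_mat_def)

lemma index_bordered_mat:
  assumes "b \<in> carrier_vec k" "S \<in> carrier_mat k k" "i < Suc k" "j < Suc k"
  shows "bordered_mat a b S $$ (i, j) =
    (case i of 0 \<Rightarrow> (case j of 0 \<Rightarrow> a | Suc j' \<Rightarrow> b $ j')
       | Suc i' \<Rightarrow> (case j of 0 \<Rightarrow> b $ i' | Suc j' \<Rightarrow> S $$ (i', j')))"
  using assms by (auto simp: bordered_mat_def split: nat.split)

lemma bordered_mat_mult_vCons: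
  assumes b: "b \<in> carrier_vec k" and S: "S \<in> carrier_mat k k" and v: "v \<in> carrier_vec k"
  shows "bordered_mat a b S *\<^sub>v vCons t v = vCons (a * t + scalar_prod b v) (t \<cdot>\<^sub>v b + S *\<^sub>v v)"
proof -
  have row0: "Matrix.row (bordered_mat a b S) 0 = vCons a b"
    using b S carrier_matD[OF bordered_mat_carrier[OF b S, of a]]
    by (intro eq_vecI) (auto simp: index_bordered_mat[OF b S] vec_index_vCons split: nat.split)
  have rowS: "Matrix.row (bordered_mat a b S) (Suc i) = vCons (b $ i) (Matrix.row S i)" if "i < k" for i
    using b S carrier_matD[OF bordered_mat_carrier[OF b S, of a]] that
    by (intro eq_vecI) (auto simp: index_bordered_mat[OF b S] vec_index_vCons split: nat.split)
  show ?thesis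
  proof (rule eq_vecI)
    show "dim_vec (bordered_mat a b S *\<^sub>v vCons t v) = dim_vec (vCons (a * t + scalar_prod b v) (t \<cdot>\<^sub>v b + S *\<^sub>v v))"
      using b S carrier_matD[OF bordered_mat_carrier[OF b S, of a]] by auto
    fix i assume i: "i < dim_vec (vCons (a * t + scalar_prod b v) (t \<cdot>\<^sub>v b + S *\<^sub>v v))"
    show "(bordered_mat a b S *\<^sub>v vCons t v) $ i = vCons (a * t + scalar_prod b v) (t \<cdot>\<^sub>v b + S *\<^sub>v v) $ i"
      using i b S carrier_matD[OF bordered_mat_carrier[OF b S, of a]]
      by (cases i) (auto simp: row0 rowS)
  qed
qed

text \<open>Lets an induction on the dimension peel off coordinate 0; used for the positivity of the
  determinant and for the total mass of the normal law.\<close>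

lemma symmetric_mat_eq_bordered:
  assumes A: "A \<in> carrier_mat (Suc k) (Suc k)" and sym: "transpose_mat A = A"
  obtains a b S where "b \<in> carrier_vec k" "S \<in> carrier_mat k k" "A = bordered_mat a b S"
proof (rule that)
  let ?b = "Matrix.vec k (\<lambda>i. A $$ (0, Suc i))" and ?S = "Matrix.mat k k (\<lambda>(i, j). A $$ (Suc i, Suc j))"
  show b: "?b \<in> carrier_vec k" and S: "?S \<in> carrier_mat k k" by auto
  have flip: "A $$ (i, j) = A $$ (j, i)" if "i < Suc k" "j < Suc k" for i j
    using A that by (subst sym[symmetric]) auto
  show "A = bordered_mat (A $$ (0, 0)) ?b ?S"
  proof (rule eq_matI)
    fix i j assume "i < dim_row (bordered_mat (A $$ (0, 0)) ?b ?S)" "j < dim_col (bordered_mat (A $$ (0, 0)) ?b ?S)"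
    then have "i < Suc k" "j < Suc k" by (simp_all only: carrier_matD[OF bordered_mat_carrier[OF b S]])
    then show "A $$ (i, j) = bordered_mat (A $$ (0, 0)) ?b ?S $$ (i, j)"
      using flip[of i 0] by (auto simp: index_bordered_mat[OF b S] split: nat.split)
  qed (use A in \<open>simp_all only: carrier_matD[OF bordered_mat_carrier[OF b S]] carrier_matD[OF A]\<close>)
qed

section \<open>Inverses and principal blocks of positive definite matrices\<close>

lemma vec_neg_scalar: "(-1) \<cdot>\<^sub>v v = - (v :: real Matrix.vec)"
  by (intro eq_vecI) auto

text \<open>A nonzero kernel vector would have quadratic form 0, so the determinant is nonzero and
  \<open>mat_inverse\<close> returns a value. This justifies the \<open>the\<close> in
  \<open>inverse_mat\<close>.\<close>

lemma positive_definite_inverse: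
  assumes "positive_definite_mat k A"
  shows "inverse_mat A \<in> carrier_mat k k" "A * inverse_mat A = 1\<^sub>m k" "inverse_mat A * A = 1\<^sub>m k"
proof -
  have A: "A \<in> carrier_mat k k" using assms by (simp add: positive_definite_mat_def)
  have "Determinant.det A \<noteq> 0"
  proof
    assume "Determinant.det A = 0"
    then obtain v where "v \<in> carrier_vec k" "v \<noteq> 0\<^sub>v k" "A *\<^sub>v v = 0\<^sub>v k"
      using det_0_iff_vec_prod_zero[OF A] by auto
    then show False using assms by (force simp: positive_definite_mat_def)
  qed
  then have "A \<in> Units (ring_mat TYPE(real) k ())" by (rule det_non_zero_imp_unit[OF A])
  then obtain B where "mat_inverse A = Some B" using mat_inverse(1)[OF A] by fastforce
  then show "inverse_mat A \<in> carrier_mat k k" "A * inverse_mat A = 1\<^sub>m k" "inverse_mat A * A = 1\<^sub>m k"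
    using mat_inverse(2)[OF A] by (auto simp: inverse_mat_def)
qed

lemma positive_definite_inverse_mult_cancel:
  assumes "positive_definite_mat k A" "x \<in> carrier_vec k"
  shows "A *\<^sub>v (inverse_mat A *\<^sub>v x) = x" "inverse_mat A *\<^sub>v (A *\<^sub>v x) = x"
proof -
  have A: "A \<in> carrier_mat k k" using assms by (simp add: positive_definite_mat_def)
  show "A *\<^sub>v (inverse_mat A *\<^sub>v x) = x" "inverse_mat A *\<^sub>v (A *\<^sub>v x) = x"
    using positive_definite_inverse[OF assms(1)] A assms(2)
    by (simp_all add: assoc_mult_mat_vec[symmetric, of _ k k _ k])
qed

lemma positive_definite_dot_commute:
  assumes "positive_definite_mat k A" "x \<in> carrier_vec k" "y \<in> carrier_vec k"
  shows "scalar_prod x (A *\<^sub>v y) = scalar_prod (A *\<^sub>v x) y"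
  using transpose_vec_mult_scalar[of A k k y x] assms by (simp add: positive_definite_mat_def)

text \<open>Symmetry passes to the inverse by writing \<open>x\<close> as \<open>A\<close> applied
  to its preimage and moving this \<open>A\<close> to the other factor.\<close>

lemma inverse_mat_dot_commute:
  assumes "positive_definite_mat k A" "x \<in> carrier_vec k" "y \<in> carrier_vec k"
  shows "scalar_prod x (inverse_mat A *\<^sub>v y) = scalar_prod (inverse_mat A *\<^sub>v x) y"
proof -
  note c = positive_definite_inverse(1)[OF assms(1)]
  have "scalar_prod (A *\<^sub>v (inverse_mat A *\<^sub>v x)) (inverse_mat A *\<^sub>v y)
      = scalar_prod (inverse_mat A *\<^sub>v x) (A *\<^sub>v (inverse_mat A *\<^sub>v y))"
    using assms c by (intro positive_definite_dot_commute[symmetric, OF assms(1)]) auto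
  then show ?thesis using assms by (simp add: positive_definite_inverse_mult_cancel)
qed

text \<open>On vectors with leading entry 0 the quadratic form of the bordered matrix is that of the
  block.\<close>

lemma positive_definite_bordered_block:
  assumes b: "b \<in> carrier_vec k" and S: "S \<in> carrier_mat k k"
    and pd: "positive_definite_mat (Suc k) (bordered_mat a b S)"
  shows "positive_definite_mat k S"
  unfolding positive_definite_mat_def
proof (intro conjI ballI impI)
  have flip: "bordered_mat a b S $$ (i, j) = bordered_mat a b S $$ (j, i)" if "i < Suc k" "j < Suc k" for i j
  proof -
    have "transpose_mat (bordered_mat a b S) $$ (i, j) = bordered_mat a b S $$ (j, i)"
      using that carrier_matD[OF bordered_mat_carrier[OF b S, of a]] by simp
    then show ?thesis using pd by (simp add: positive_definite_mat_def)
  qed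
  have "S $$ (j, i) = S $$ (i, j)" if "i < k" "j < k" for i j
    using flip[of "Suc i" "Suc j"] that by (simp add: index_bordered_mat[OF b S])
  then show "transpose_mat S = S" using S by (intro eq_matI) auto
  fix v :: "real Matrix.vec" assume v: "v \<in> carrier_vec k" "v \<noteq> 0\<^sub>v k"
  have "scalar_prod (vCons 0 v) (bordered_mat a b S *\<^sub>v vCons 0 v) > 0"
    using pd v by (simp add: positive_definite_mat_def zero_vec_Suc)
  moreover have "0 \<cdot>\<^sub>v b + S *\<^sub>v v = S *\<^sub>v v" using b S v by (intro eq_vecI) auto
  ultimately show "scalar_prod v (S *\<^sub>v v) > 0"
    using bordered_mat_mult_vCons[OF b S v(1), of a 0] by simp
qed fact

text \<open>The conditional variance of coordinate 0 given the other coordinates. For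
  \<open>a = 1\<close> and \<open>b = \<rho>1 \<cdot>\<^sub>v ones_vec n\<close> its square root is
  \<open>cond_sd\<close>.\<close>

definition schur_complement :: "real \<Rightarrow> real Matrix.vec \<Rightarrow> real Matrix.mat \<Rightarrow> real" where
  "schur_complement a b S = a - scalar_prod b (inverse_mat S *\<^sub>v b)"

context
  fixes k a b S
  assumes b: "b \<in> carrier_vec k" and S: "S \<in> carrier_mat k k"
    and pd: "positive_definite_mat (Suc k) (bordered_mat a b S)"
begin

lemma bordered_block_pd: "positive_definite_mat k S"
  by (rule positive_definite_bordered_block[OF b S pd])

text \<open>It is the value of the quadratic form at the vector with leading entry 1 and remainder
  \<open>- (inverse_mat S *\<^sub>v b)\<close>, which minimises the form among the vectors with
  leading entry 1.\<close>

lemma schur_complement_pos: "schur_complement a b S > 0"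
proof -
  let ?\<beta> = "inverse_mat S *\<^sub>v b"
  note c = positive_definite_inverse[OF bordered_block_pd]
  have \<beta>: "?\<beta> \<in> carrier_vec k" using c b by auto
  have cancel: "1 \<cdot>\<^sub>v b + S *\<^sub>v (- ?\<beta>) = 0\<^sub>v k"
  proof -
    have "S *\<^sub>v (- ?\<beta>) = - b"
      using positive_definite_inverse_mult_cancel(1)[OF bordered_block_pd b] mult_mat_vec[OF S \<beta>, of "-1"]
      by (simp add: vec_neg_scalar)
    then show ?thesis using b by (intro eq_vecI) auto
  qed
  have "scalar_prod (vCons 1 (- ?\<beta>)) (bordered_mat a b S *\<^sub>v vCons 1 (- ?\<beta>)) > 0"
    using pd \<beta> by (simp add: positive_definite_mat_def zero_vec_Suc)
  then show ?thesis
    using \<beta> b unfolding bordered_mat_mult_vCons[OF b S uminus_carrier_vec[THEN iffD2, OF \<beta>]] cancel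
    using scalar_prod_uminus_right[of b ?\<beta>] carrier_vecD[OF b] carrier_vecD[OF \<beta>] by (simp add: schur_complement_def)
qed

text \<open>Column elimination: multiplication by \<open>?L\<close> subtracts from column 0 the
  combination of the other columns with coefficients \<open>inverse_mat S *\<^sub>v b\<close>. This
  clears column 0 below the corner and leaves the Schur complement in the corner, while
  \<open>?L\<close> has determinant 1.\<close>

lemma det_bordered_mat: "Determinant.det (bordered_mat a b S) = schur_complement a b S * Determinant.det S"
proof -
  let ?\<beta> = "inverse_mat S *\<^sub>v b"
  note c = positive_definite_inverse[OF bordered_block_pd]
  have \<beta>: "?\<beta> \<in> carrier_vec k" using c b by auto
  let ?B = "Matrix.mat k 1 (\<lambda>(i, j). - ?\<beta> $ i)"
  let ?L = "four_block_mat (1\<^sub>m 1) (0\<^sub>m 1 k) ?B (1\<^sub>m k)"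
  let ?U = "four_block_mat (Matrix.mat 1 1 (\<lambda>_. schur_complement a b S)) (Matrix.mat 1 k (\<lambda>(i, j). b $ j))
     (0\<^sub>m k 1) S"
  have S\<beta>: "scalar_prod (Matrix.row S i) ?\<beta> = b $ i" if "i < k" for i
    using arg_cong[OF positive_definite_inverse_mult_cancel(1)[OF bordered_block_pd b], of "\<lambda>v. v $ i"] S that by simp
  have colB: "Matrix.col ?B 0 = - ?\<beta>" using carrier_vecD[OF \<beta>] by (intro eq_vecI) (auto simp del: index_mult_mat_vec)
  have rowb: "Matrix.row (Matrix.mat 1 k (\<lambda>(i, j). b $ j)) 0 = b" using b by (intro eq_vecI) auto
  \<comment> \<open>\<open>1\<close> and \<open>3\<close> are the upper left and lower left blocks
    of the product with \<open>?L\<close>; the right-hand blocks do not change.\<close>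
  have 1: "Matrix.mat 1 1 (\<lambda>_. a) * 1\<^sub>m 1 + Matrix.mat 1 k (\<lambda>(i, j). b $ j) * ?B
      = Matrix.mat 1 1 (\<lambda>_. schur_complement a b S)"
  proof (rule eq_matI)
    fix i j assume "i < dim_row (Matrix.mat 1 1 (\<lambda>_. schur_complement a b S))"
      "j < dim_col (Matrix.mat 1 1 (\<lambda>_. schur_complement a b S))"
    then have ij: "i = 0" "j = 0" by auto
    have "(Matrix.mat 1 k (\<lambda>(i, j). b $ j) * ?B) $$ (0, 0)
        = scalar_prod (Matrix.row (Matrix.mat 1 k (\<lambda>(i, j). b $ j)) 0) (Matrix.col ?B 0)"
      by (subst index_mult_mat) auto
    also have "\<dots> = - scalar_prod b ?\<beta>"
      unfolding rowb colB
      by (rule scalar_prod_uminus_right) (simp only: carrier_vecD[OF b] carrier_vecD[OF \<beta>])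
    finally show "(Matrix.mat 1 1 (\<lambda>_. a) * 1\<^sub>m 1 + Matrix.mat 1 k (\<lambda>(i, j). b $ j) * ?B) $$ (i, j)
        = Matrix.mat 1 1 (\<lambda>_. schur_complement a b S) $$ (i, j)"
      using ij by (simp add: schur_complement_def del: index_mult_mat(1))
  qed auto
  have 3: "Matrix.mat k 1 (\<lambda>(i, j). b $ i) * 1\<^sub>m 1 + S * ?B = 0\<^sub>m k 1"
  proof (rule eq_matI)
    fix i j assume "i < dim_row (0\<^sub>m k 1 :: real Matrix.mat)" "j < dim_col (0\<^sub>m k 1 :: real Matrix.mat)"
    then have ij: "i < k" "j = 0" by auto
    have "(S * ?B) $$ (i, j) = scalar_prod (Matrix.row S i) (- ?\<beta>)"
      using ij S colB by simp
    also have "\<dots> = - b $ i" using S\<beta>[OF ij(1)] scalar_prod_uminus_right[of "Matrix.row S i" ?\<beta>]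
        carrier_matD[OF S] carrier_vecD[OF \<beta>] by simp
    finally show "(Matrix.mat k 1 (\<lambda>(i, j). b $ i) * 1\<^sub>m 1 + S * ?B) $$ (i, j) = 0\<^sub>m k 1 $$ (i, j)"
      using ij S by simp
  qed (use S in auto)
  have "bordered_mat a b S * ?L = ?U"
    unfolding bordered_mat_def using b S
    by (subst mult_four_block_mat[of _ 1 1 _ k _ k _ _ 1 _ k]) (simp_all add: 1[simplified] 3[simplified])
  moreover have L: "?L \<in> carrier_mat (Suc k) (Suc k)"
    using four_block_carrier_mat[of "1\<^sub>m 1" 1 1 "1\<^sub>m k" k k "0\<^sub>m 1 k" ?B] by simp
  ultimately have "Determinant.det (bordered_mat a b S) * Determinant.det ?L = Determinant.det ?U"
    using det_mult[OF bordered_mat_carrier[OF b S, of a] L] by simp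
  moreover have "Determinant.det ?L = Determinant.det (1\<^sub>m 1 :: real Matrix.mat) * Determinant.det (1\<^sub>m k :: real Matrix.mat)"
    by (rule det_four_block_mat_upper_right_zero) auto
  moreover have "Determinant.det ?U = Determinant.det (Matrix.mat 1 1 (\<lambda>_. schur_complement a b S)) * Determinant.det S"
    by (rule det_four_block_mat_lower_left_zero) (use S in auto)
  ultimately show ?thesis by (simp add: det_single)
qed

text \<open>Completing the square in \<open>t\<close>: the exponent of the joint density becomes a
  sum in which \<open>t\<close> occurs only in a univariate Gaussian exponent.\<close>

lemma bordered_quadratic_form:
  assumes x: "x \<in> carrier_vec k"
  shows "scalar_prod (vCons t x) (inverse_mat (bordered_mat a b S) *\<^sub>v vCons t x)
    = scalar_prod x (inverse_mat S *\<^sub>v x)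
      + (t - scalar_prod b (inverse_mat S *\<^sub>v x))\<^sup>2 / schur_complement a b S"
proof -
  let ?s = "schur_complement a b S" and ?\<beta> = "inverse_mat S *\<^sub>v b" and ?w = "inverse_mat S *\<^sub>v x"
  \<comment> \<open>The vector \<open>vCons r v\<close> below is mapped to \<open>vCons t x\<close> by the bordered matrix;
    this replaces a block formula for the inverse.\<close>
  define r where "r = (t - scalar_prod b ?w) / ?s"
  let ?v = "?w - r \<cdot>\<^sub>v ?\<beta>"
  note c = positive_definite_inverse[OF bordered_block_pd]
  have car: "?\<beta> \<in> carrier_vec k" "?w \<in> carrier_vec k" "?v \<in> carrier_vec k" using c b x by auto
  have rs: "r * ?s = t - scalar_prod b ?w" using schur_complement_pos by (simp add: r_def)
  have bv: "scalar_prod b ?v = scalar_prod b ?w - r * scalar_prod b ?\<beta>"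
    using car b by (simp add: scalar_prod_minus_distrib)
  have top: "a * r + scalar_prod b ?v = t"
    using rs bv by (simp add: schur_complement_def algebra_simps)
  have "S *\<^sub>v ?v = x - r \<cdot>\<^sub>v b"
    using car b x S by (simp add: mult_minus_distrib_mat_vec mult_mat_vec positive_definite_inverse_mult_cancel[OF bordered_block_pd])
  then have bot: "r \<cdot>\<^sub>v b + S *\<^sub>v ?v = x" using b x by (intro eq_vecI) auto
  have "bordered_mat a b S *\<^sub>v vCons r ?v = vCons t x"
    by (simp add: bordered_mat_mult_vCons[OF b S car(3)] top bot)
  then have "inverse_mat (bordered_mat a b S) *\<^sub>v vCons t x = vCons r ?v"
    using positive_definite_inverse_mult_cancel(2)[OF pd, of "vCons r ?v"] car by simp
  then have "scalar_prod (vCons t x) (inverse_mat (bordered_mat a b S) *\<^sub>v vCons t x)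
     = t * r + (scalar_prod x ?w - r * scalar_prod x ?\<beta>)"
    using car x by (simp add: scalar_prod_minus_distrib)
  also have "scalar_prod x ?\<beta> = scalar_prod b ?w"
    using inverse_mat_dot_commute[OF bordered_block_pd b x] car x by (metis comm_scalar_prod)
  also have "t * r + (scalar_prod x ?w - r * scalar_prod b ?w) = scalar_prod x ?w + (t - scalar_prod b ?w) * r"
    by (simp add: algebra_simps)
  finally show ?thesis by (simp add: r_def power2_eq_square)
qed

end

text \<open>Each peeled coordinate contributes a positive Schur complement as a factor. In HOL
  \<open>sqrt\<close> of a negative number is negative, so \<open>mvn_density\<close> has the sign
  of the determinant and is nonnegative only thanks to this.\<close>

lemma positive_definite_det_pos: "positive_definite_mat k A \<Longrightarrow> Determinant.det A > 0"
proof (induction k arbitrary: A)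
  case 0 then show ?case by (simp add: positive_definite_mat_def)
next
  case (Suc k)
  from Suc.prems obtain a b S where A: "b \<in> carrier_vec k" "S \<in> carrier_mat k k" "A = bordered_mat a b S"
    using symmetric_mat_eq_bordered[of A k] unfolding positive_definite_mat_def by metis
  with Suc.prems have pd: "positive_definite_mat (Suc k) (bordered_mat a b S)" by simp
  show ?case unfolding A(3) det_bordered_mat[OF A(1,2) pd]
    using schur_complement_pos[OF A(1,2) pd] Suc.IH[OF positive_definite_bordered_block[OF A(1,2) pd]] by simp
qed

text \<open>The two summands of the quadratic form become the exponents of the two densities, the
  two factors of the determinant their normalising constants.\<close>

lemma mvn_density_bordered:
  assumes b: "b \<in> carrier_vec k" and S: "S \<in> carrier_mat k k"
    and pd: "positive_definite_mat (Suc k) (bordered_mat a b S)"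
  shows "mvn_density (Suc k) (bordered_mat a b S) x =
    normal_density (scalar_prod b (inverse_mat S *\<^sub>v Matrix.vec k (\<lambda>i. x (Suc i)))) (sqrt (schur_complement a b S)) (x 0)
      * mvn_density k S (\<lambda>i. x (Suc i))"
proof -
  let ?s = "schur_complement a b S" and ?x = "Matrix.vec k (\<lambda>i. x (Suc i))"
  let ?\<mu> = "scalar_prod b (inverse_mat S *\<^sub>v ?x)" and ?q = "scalar_prod ?x (inverse_mat S *\<^sub>v ?x)"
  have s: "?s > 0" by (rule schur_complement_pos[OF assms])
  have v: "Matrix.vec (Suc k) x = vCons (x 0) ?x" by (simp add: vec_Suc o_def)
  have "- (?q + (x 0 - ?\<mu>)\<^sup>2 / ?s) / 2 = - (x 0 - ?\<mu>)\<^sup>2 / (2 * ?s) + - ?q / 2"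
    using s by (simp add: field_simps)
  moreover have "sqrt ((2 * pi) ^ Suc k * (?s * Determinant.det S))
      = sqrt (2 * pi * ?s) * sqrt ((2 * pi) ^ k * Determinant.det S)"
    by (simp add: real_sqrt_mult)
  ultimately show ?thesis
    using s by (simp add: mvn_density_def v bordered_quadratic_form[OF assms] det_bordered_mat[OF assms]
      normal_density_def exp_add[symmetric] del: power_Suc)
qed

section \<open>The normal distribution function and powers of Lebesgue measure\<close>

lemma isCont_std_normal_cdf: "isCont std_normal_cdf x"
proof -
  interpret real_distribution std_normal_distribution by (rule real_dist_normal_dist)
  have "emeasure std_normal_distribution {x} = 0" by (simp add: emeasure_density)
  then have "measure std_normal_distribution {x} = 0" by (simp add: measure_def)
  then show ?thesis by (simp add: std_normal_cdf_def isCont_cdf)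
qed

text \<open>Otherwise the interval between the two points would be null for the normal law, hence
  for Lebesgue measure, because the density vanishes nowhere.\<close>

lemma std_normal_cdf_strict_mono: "x < y \<Longrightarrow> std_normal_cdf x < std_normal_cdf y"
proof (rule ccontr)
  interpret real_distribution std_normal_distribution by (rule real_dist_normal_dist)
  assume xy: "x < y" and "\<not> std_normal_cdf x < std_normal_cdf y"
  then have "measure std_normal_distribution {x<..y} \<le> 0"
    using cdf_diff_eq[OF xy] by (simp add: std_normal_cdf_def)
  then have "emeasure std_normal_distribution {x<..y} = 0"
    by (simp add: emeasure_eq_measure measure_le_0_iff)
  then have "(\<integral>\<^sup>+t. ennreal (std_normal_density t) * indicator {x<..y} t \<partial>lborel) = 0"
    by (simp add: emeasure_density)
  then have "AE t in lborel. ennreal (std_normal_density t) * indicator {x<..y} t = 0"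
    by (subst (asm) nn_integral_0_iff_AE) auto
  then have "AE t in lborel. t \<notin> {x<..y}"
    by eventually_elim (use normal_density_pos[of 1 0] in \<open>auto simp: indicator_def less_le split: if_splits\<close>)
  then have "emeasure lborel {x<..y} = 0"
    by (subst (asm) AE_iff_measurable[OF _ refl]) (auto simp: Collect_conj_eq greaterThanAtMost_def greaterThan_def atMost_def)
  with xy show False by simp
qed

lemma std_normal_cdf_le_iff: "std_normal_cdf x \<le> std_normal_cdf y \<longleftrightarrow> x \<le> y"
  by (rule strict_mono_less_eq) (simp add: strict_mono_def std_normal_cdf_strict_mono)

lemma std_normal_cdf_bounds: "0 < std_normal_cdf x" "std_normal_cdf x < 1"
proof -
  interpret real_distribution std_normal_distribution by (rule real_dist_normal_dist)
  have "0 \<le> std_normal_cdf (x - 1)" by (simp add: std_normal_cdf_def cdf_nonneg)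
  also have "\<dots> < std_normal_cdf x" by (rule std_normal_cdf_strict_mono) simp
  finally show "0 < std_normal_cdf x" .
  have "std_normal_cdf x < std_normal_cdf (x + 1)" by (rule std_normal_cdf_strict_mono) simp
  also have "\<dots> \<le> 1" by (simp add: std_normal_cdf_def cdf_bounded_prob)
  finally show "std_normal_cdf x < 1" .
qed

text \<open>Intermediate values between the limits 0 and 1 at the two ends. It gives the existence
  of normal quantiles and, for the severity law, a preimage of each level in the probability
  integral transform.\<close>

lemma real_distribution_cdf_attains:
  assumes "real_distribution D" and cont: "\<And>x. isCont (cdf D) x" and u: "0 < u" "u < 1"
  shows "\<exists>x. cdf D x = u"
proof -
  interpret real_distribution D by fact
  obtain a where a: "cdf D a < u"
    using order_tendstoD(2)[OF cdf_lim_at_bot u(1)] by (auto simp: eventually_at_bot_linorder)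
  obtain b where b: "u < cdf D b"
    using order_tendstoD(1)[OF cdf_lim_at_top_prob u(2)] by (auto simp: eventually_at_top_linorder)
  have "a \<le> b" using a b cdf_nondecreasing[of b a] by linarith
  then show ?thesis using IVT[of "cdf D" a u b] a b cont by auto
qed

lemma std_normal_quantile_cdf [simp]: "std_normal_quantile (std_normal_cdf x) = ereal x"
proof -
  have "(THE t. std_normal_cdf t = std_normal_cdf x) = x"
    by (rule the_equality) (simp_all add: eq_iff std_normal_cdf_le_iff)
  then show ?thesis using std_normal_cdf_bounds[of x] by (simp add: std_normal_quantile_def)
qed

text \<open>A case rule that spares later proofs the definite description: a level strictly between
  0 and 1 is replaced by \<open>std_normal_cdf t\<close>.\<close>

lemma std_normal_quantile_cases:
  obtains "u \<le> 0" "std_normal_quantile u = -\<infinity>" | "u \<ge> 1" "std_normal_quantile u = \<infinity>"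
  | t where "u = std_normal_cdf t" "std_normal_quantile u = ereal t"
proof -
  have "\<exists>t. std_normal_cdf t = u" if "0 < u" "u < 1"
    using real_distribution_cdf_attains[OF real_dist_normal_dist _ that]
      isCont_std_normal_cdf by (simp add: std_normal_cdf_def)
  then consider "u \<le> 0" | "u \<ge> 1" | t where "u = std_normal_cdf t" by fastforce
  then show ?thesis
  proof cases
    case 3
    then show ?thesis using that(3) by simp
  qed (use that(1,2) in \<open>auto simp: std_normal_quantile_def\<close>)
qed

text \<open>A Galois connection that survives at infinite quantiles because \<Phi> never takes the
  values 0 and 1. It moves copula orthants between the normal scale and the uniform scale.\<close>

lemma le_std_normal_quantile_iff: "ereal x \<le> std_normal_quantile u \<longleftrightarrow> std_normal_cdf x \<le> u"
  using std_normal_cdf_bounds[of x]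
  by (cases u rule: std_normal_quantile_cases) (auto simp: std_normal_cdf_le_iff)

lemma std_normal_quantile_mono: "u \<le> v \<Longrightarrow> std_normal_quantile u \<le> std_normal_quantile v"
  by (cases u rule: std_normal_quantile_cases) (auto simp: le_std_normal_quantile_iff, simp add: std_normal_quantile_def)

lemma borel_measurable_real_std_normal_quantile [measurable]:
  "(\<lambda>u. real_of_ereal (std_normal_quantile u)) \<in> borel_measurable borel"
proof (rule borel_measurableI_le)
  fix a :: real
  \<comment> \<open>\<open>real_of_ereal\<close> sends both infinities to 0, so the levels outside
    the open unit interval belong to the sublevel set exactly if \<open>0 \<le> a\<close>.\<close>
  have "{u \<in> space borel. real_of_ereal (std_normal_quantile u) \<le> a}
      = ({0<..<1} \<inter> {..std_normal_cdf a}) \<union> (if 0 \<le> a then - {0<..<1} else {})"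
  proof (intro Set.set_eqI)
    fix u show "u \<in> {u \<in> space borel. real_of_ereal (std_normal_quantile u) \<le> a} \<longleftrightarrow>
      u \<in> ({0<..<1} \<inter> {..std_normal_cdf a}) \<union> (if 0 \<le> a then - {0<..<1} else {})"
      by (cases u rule: std_normal_quantile_cases) (use std_normal_cdf_bounds in \<open>auto simp: std_normal_cdf_le_iff\<close>)
  qed
  then show "{u \<in> space borel. real_of_ereal (std_normal_quantile u) \<le> a} \<in> sets borel" by simp
qed

lemma borel_measurable_std_normal_cdf [measurable]: "std_normal_cdf \<in> borel_measurable borel"
  by (intro borel_measurable_continuous_onI continuous_at_imp_continuous_on ballI isCont_std_normal_cdf)

lemma std_normal_cdf_ext_ereal [simp]: "std_normal_cdf_ext (ereal x) = std_normal_cdf x"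
  by (simp add: std_normal_cdf_ext_def)

lemma std_normal_cdf_ext_infinity [simp]: "std_normal_cdf_ext \<infinity> = 1" "std_normal_cdf_ext (-\<infinity>) = 0"
  by (simp_all add: std_normal_cdf_ext_def)

lemma std_normal_cdf_ext_mono: "e \<le> e' \<Longrightarrow> std_normal_cdf_ext e \<le> std_normal_cdf_ext e'"
  by (cases e; cases e') (use std_normal_cdf_bounds in \<open>auto simp: std_normal_cdf_le_iff intro: less_imp_le\<close>)

lemma std_normal_cdf_ext_bounds: "0 \<le> std_normal_cdf_ext e" "std_normal_cdf_ext e \<le> 1"
  by (cases e; use std_normal_cdf_bounds in \<open>auto intro: less_imp_le\<close>)+

text \<open>Substitution of \<open>\<mu> + \<sigma> * t\<close> reduces a finite bound to the
  standard normal law. The bound \<open>\<infinity>\<close> covers the total mass and counts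
  \<open>n\<close> with \<open>F1 n = 1\<close>, the bound \<open>-\<infinity>\<close> the level
  \<open>F1 0 = 0\<close>.\<close>

lemma nn_integral_normal_density_le:
  assumes \<sigma>: "\<sigma> > 0"
  shows "(\<integral>\<^sup>+t. ennreal (normal_density \<mu> \<sigma> t) * indicator {t. ereal t \<le> e} t \<partial>lborel)
    = ennreal (std_normal_cdf_ext ((e - ereal \<mu>) / ereal \<sigma>))"
proof (cases e)
  case (real a)
  interpret real_distribution std_normal_distribution by (rule real_dist_normal_dist)
  have nd: "\<sigma> * normal_density \<mu> \<sigma> (\<mu> + \<sigma> * t) = std_normal_density t" for t
    using \<sigma> by (simp add: normal_density_def real_sqrt_mult power_mult_distrib field_simps)
  have le: "\<mu> + \<sigma> * t \<le> a \<longleftrightarrow> t \<le> (a - \<mu>) / \<sigma>" for t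
    using \<sigma> by (simp add: field_simps)
  have "(\<integral>\<^sup>+t. ennreal (normal_density \<mu> \<sigma> t) * indicator {t. ereal t \<le> e} t \<partial>lborel)
      = \<bar>\<sigma>\<bar> * (\<integral>\<^sup>+t. ennreal (normal_density \<mu> \<sigma> (\<mu> + \<sigma> * t)) * indicator {t. ereal t \<le> e} (\<mu> + \<sigma> * t) \<partial>lborel)"
    using \<sigma> by (intro nn_integral_real_affine) (auto simp: real)
  also have "\<dots> = (\<integral>\<^sup>+t. ennreal (\<sigma> * normal_density \<mu> \<sigma> (\<mu> + \<sigma> * t)) * indicator {..(a - \<mu>) / \<sigma>} t \<partial>lborel)"
    using \<sigma> by (subst nn_integral_cmult[symmetric])
      (auto simp: real le indicator_def ennreal_mult mult.assoc intro!: nn_integral_cong)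
  also have "\<dots> = emeasure std_normal_distribution {..(a - \<mu>) / \<sigma>}"
    by (simp add: nd emeasure_density)
  also have "\<dots> = ennreal (std_normal_cdf ((a - \<mu>) / \<sigma>))"
    by (simp add: emeasure_eq_measure std_normal_cdf_def cdf_def2)
  finally show ?thesis
    using \<sigma> by (simp only: real std_normal_cdf_ext_ereal[symmetric]) simp
next
  case PInf
  then show ?thesis
    using prob_space.emeasure_space_1[OF prob_space_normal_density[OF \<sigma>, of \<mu>]] \<sigma>
    by (simp add: emeasure_density)
next
  case MInf
  then show ?thesis using \<sigma> by simp
qed

section \<open>Measures on powers of the real line\<close>

lemma sets_lborel_pow: "sets (lborel_pow n) = sets (PiM {..<n} (\<lambda>_. borel))"
  by (intro sets_PiM_cong) auto

text \<open>Lower boxes are stable under intersection, by taking minima of corners, and generate the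
  product \<sigma>-algebra. Boxes with all corner entries equal to a natural number exhaust the
  space and have finite mass under \<open>P\<close>.\<close>

lemma measure_eqI_lower_boxes:
  fixes P Q :: "(nat \<Rightarrow> real) measure"
  assumes P: "finite_measure P" "sets P = sets (PiM {..<n} (\<lambda>_. borel))"
    and Q: "sets Q = sets (PiM {..<n} (\<lambda>_. borel))"
    and eq: "\<And>y. emeasure P {x \<in> space P. \<forall>i<n. x i \<le> y i} = emeasure Q {x \<in> space P. \<forall>i<n. x i \<le> y i}"
  shows "P = Q"
proof -
  let ?\<Omega> = "\<Pi>\<^sub>E i\<in>{..<n}. (UNIV :: real set)"
  let ?E = "{{f \<in> ?\<Omega>. \<forall>i\<in>j. f i \<in> A i} | A j. j \<in> {{..<n}} \<and> A \<in> Pi j (\<lambda>_. range atMost)}"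
  have sp: "space P = ?\<Omega>" using sets_eq_imp_space_eq[OF P(2)] by (simp add: space_PiM)
  \<comment> \<open>\<open>?E\<close> is the generator in the form that
    \<open>sets_PiM_sigma\<close> produces; the right-hand side indexes it by corner points.\<close>
  have E: "?E = range (\<lambda>y. {x \<in> space P. \<forall>i<n. x i \<le> (y i :: real)})" (is "_ = ?R")
  proof (intro equalityI subsetI)
    fix X assume "X \<in> ?E"
    then obtain A where X: "X = {f \<in> ?\<Omega>. \<forall>i\<in>{..<n}. f i \<in> A i}" and A: "A \<in> Pi {..<n} (\<lambda>_. range atMost)"
      by blast
    have "\<forall>i<n. \<exists>y. A i = {..y}" using A by (auto simp: Pi_def)
    then obtain y where "\<forall>i<n. A i = {..y i}" by metis
    then have "X = {x \<in> space P. \<forall>i<n. x i \<le> y i}" unfolding X sp by auto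
    then show "X \<in> ?R" by blast
  next
    fix X assume "X \<in> ?R"
    then obtain y where "X = {x \<in> space P. \<forall>i<n. x i \<le> (y i :: real)}" by blast
    then have "X = {f \<in> ?\<Omega>. \<forall>i\<in>{..<n}. f i \<in> {..y i}}" unfolding sp by auto
    then show "X \<in> ?E" by (intro CollectI exI[of _ "\<lambda>i. {..y i}"] exI[of _ "{..<n}"]) auto
  qed
  have "sets (PiM {..<n} (\<lambda>_. borel :: real measure)) = sets (\<Pi>\<^sub>M i\<in>{..<n}. sigma UNIV (range atMost))"
    by (simp add: borel_eq_atMost)
  also have "\<dots> = sets (sigma ?\<Omega> ?E)"
  proof (rule sets_PiM_sigma)
    fix i assume "i \<in> {..<n}"
    show "\<exists>S\<subseteq>range atMost. countable S \<and> (UNIV :: real set) = \<Union>S"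
    proof (intro exI[of _ "range (\<lambda>k::nat. {..real k})"] conjI)
      show "UNIV = \<Union> (range (\<lambda>k::nat. {..real k}))"
        using real_arch_simple by auto
    qed auto
  qed auto
  also have "\<dots> = sigma_sets ?\<Omega> ?E" by (rule sets_measure_of) auto
  finally have sigma: "sets (PiM {..<n} (\<lambda>_. borel :: real measure)) = sigma_sets ?\<Omega> ?R"
    by (simp only: E)
  show ?thesis
  proof (rule measure_eqI_generator_eq[where E = ?R and \<Omega> = ?\<Omega> and
        A = "\<lambda>k::nat. {x \<in> space P. \<forall>i<n. x i \<le> real k}"])
    show "Int_stable ?R"
    proof (rule Int_stableI)
      fix A B assume "A \<in> ?R" "B \<in> ?R"
      then obtain y y' where "A = {x \<in> space P. \<forall>i<n. x i \<le> y i}" "B = {x \<in> space P. \<forall>i<n. x i \<le> y' i}"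
        by blast
      then have "A \<inter> B = {x \<in> space P. \<forall>i<n. x i \<le> min (y i) (y' i)}" by auto
      then show "A \<inter> B \<in> ?R" by (rule range_eqI[where x = "\<lambda>i. min (y i) (y' i)"])
    qed
    show "(\<Union>k. {x \<in> space P. \<forall>i<n. x i \<le> real k}) = ?\<Omega>"
    proof (intro equalityI subsetI)
      fix x assume "x \<in> ?\<Omega>"
      moreover obtain k :: nat where k: "Max (insert 0 (x ` {..<n})) \<le> real k"
        by (rule exE[OF real_arch_simple])
      have "\<forall>i<n. x i \<le> real k"
      proof (intro allI impI)
        fix i assume "i < n"
        then have "x i \<le> Max (insert 0 (x ` {..<n}))" by (intro Max_ge) auto
        then show "x i \<le> real k" using k by linarith
      qed
      ultimately show "x \<in> (\<Union>k. {x \<in> space P. \<forall>i<n. x i \<le> real k})" by (auto simp: sp)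
    qed (auto simp: sp)
    show "emeasure P {x \<in> space P. \<forall>i<n. x i \<le> real k} \<noteq> \<infinity>" for k
      using P(1) by (simp add: finite_measure.emeasure_finite)
    show "sets P = sigma_sets ?\<Omega> ?R" "sets Q = sigma_sets ?\<Omega> ?R"
      using P(2) Q sigma by simp_all
    show "range (\<lambda>k::nat. {x \<in> space P. \<forall>i<n. x i \<le> real k}) \<subseteq> ?R"
      by (rule image_subsetI) (rule range_eqI[where x = "\<lambda>_. real _"], rule refl)
    show "emeasure P X = emeasure Q X" if "X \<in> ?R" for X
      using that by (elim imageE) (simp only: eq)
  qed (auto simp: sp)
qed

text \<open>A product measure is determined on rectangles, where the integral of a product of
  one-variable functions factors.\<close>

lemma PiM_density_lborel:
  assumes f: "f \<in> borel_measurable borel" and sf: "sigma_finite_measure (density lborel f)"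
  shows "PiM {..<n} (\<lambda>_. density lborel f) = density (lborel_pow n) (\<lambda>x. \<Prod>i<n. f (x i))"
proof -
  interpret L: product_sigma_finite "\<lambda>_::nat. lborel :: real measure"
    by (simp add: product_sigma_finite_def sigma_finite_lborel)
  interpret D: product_sigma_finite "\<lambda>_::nat. density lborel f"
    by (simp add: product_sigma_finite_def sf)
  note f[measurable]
  show ?thesis
  proof (rule D.PiM_eqI[symmetric])
    show "sets (density (lborel_pow n) (\<lambda>x. \<Prod>i<n. f (x i))) = sets (PiM {..<n} (\<lambda>_. density lborel f))"
      by (simp cong: sets_PiM_cong)
    fix A assume "\<And>i. i \<in> {..<n} \<Longrightarrow> A i \<in> sets (density lborel f)"
    then have A[measurable]: "\<And>i. i \<in> {..<n} \<Longrightarrow> A i \<in> sets borel" by simp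
    have "emeasure (density (lborel_pow n) (\<lambda>x. \<Prod>i<n. f (x i))) (Pi\<^sub>E {..<n} A)
        = (\<integral>\<^sup>+x. (\<Prod>i<n. f (x i)) * indicator (Pi\<^sub>E {..<n} A) x \<partial>lborel_pow n)"
      using A by (intro emeasure_density) (auto intro!: sets_PiM_I_finite)
    also have "\<dots> = (\<integral>\<^sup>+x. (\<Prod>i<n. f (x i) * indicator (A i) (x i)) \<partial>lborel_pow n)"
      by (intro nn_integral_cong)
        (auto simp: prod.distrib indicator_def PiE_def space_PiM Pi_def intro!: prod.neutral)
    also have "\<dots> = (\<Prod>i<n. \<integral>\<^sup>+t. f t * indicator (A i) t \<partial>lborel)"
      by (intro L.product_nn_integral_prod[where f = "\<lambda>i t. f t * indicator (A i) t"]) auto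
    also have "\<dots> = (\<Prod>i<n. emeasure (density lborel f) (A i))"
      by (intro prod.cong refl emeasure_density[symmetric]) auto
    finally show "emeasure (density (lborel_pow n) (\<lambda>x. \<Prod>i<n. f (x i))) (Pi\<^sub>E {..<n} A)
        = (\<Prod>i<n. emeasure (density lborel f) (A i))" .
  qed auto
qed

lemma measurable_component_lborel_pow:
  "i < k \<Longrightarrow> (\<lambda>x. x i) \<in> borel_measurable (lborel_pow k)"
  using measurable_component_singleton[of i "{..<k}" "\<lambda>_. lborel"] by simp

lemma sets_lower_box: "{x \<in> space (lborel_pow n). \<forall>i<n. x i \<le> u i} \<in> sets (lborel_pow n)"
proof -
  note [measurable] = measurable_component_lborel_pow[of _ n]
  have "{x \<in> space (lborel_pow n). \<forall>i\<in>{..<n}. x i \<le> u i} \<in> sets (lborel_pow n)" by measurable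
  then show ?thesis by (simp add: Ball_def)
qed

lemma measurable_cons_lborel_pow:
  "(\<lambda>(t, x). \<lambda>i\<in>{..<Suc k}. case_nat t x i) \<in> measurable (lborel \<Otimes>\<^sub>M lborel_pow k) (lborel_pow (Suc k))"
proof -
  have "(\<lambda>p. case_nat (fst p) (snd p) i) \<in> borel_measurable (lborel \<Otimes>\<^sub>M lborel_pow k)" if "i < Suc k" for i
    using that by (cases i) (auto intro!: measurable_compose[OF measurable_snd measurable_component_lborel_pow])
  then show ?thesis by (auto simp: split_beta' intro!: measurable_restrict)
qed

text \<open>The new coordinate enters at index 0 and the others shift by one, to match a border in
  row and column 0. Comparison on rectangles suffices.\<close>

lemma lborel_pow_Suc:
  "distr (lborel \<Otimes>\<^sub>M lborel_pow k) (lborel_pow (Suc k)) (\<lambda>(t, x). \<lambda>i\<in>{..<Suc k}. case_nat t x i) = lborel_pow (Suc k)"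
proof -
  interpret L: product_sigma_finite "\<lambda>_::nat. lborel :: real measure"
    by (simp add: product_sigma_finite_def sigma_finite_lborel)
  interpret K: finite_product_sigma_finite "\<lambda>_::nat. lborel :: real measure" "{..<k}" by standard auto
  let ?c = "\<lambda>(t, x). \<lambda>i\<in>{..<Suc k}. case_nat t x i :: real"
  show ?thesis
  proof (rule L.PiM_eqI)
    fix A :: "nat \<Rightarrow> real set" assume A: "\<And>i. i \<in> {..<Suc k} \<Longrightarrow> A i \<in> sets lborel"
    have "?c -` Pi\<^sub>E {..<Suc k} A \<inter> space (lborel \<Otimes>\<^sub>M lborel_pow k) = A 0 \<times> (\<Pi>\<^sub>E i\<in>{..<k}. A (Suc i))"
    proof (intro Set.set_eqI iffI)
      fix p assume "p \<in> ?c -` Pi\<^sub>E {..<Suc k} A \<inter> space (lborel \<Otimes>\<^sub>M lborel_pow k)"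
      then obtain t x where p: "p = (t, x)" "x \<in> extensional {..<k}" "\<And>i. i < Suc k \<Longrightarrow> case_nat t x i \<in> A i"
        by (cases p) (auto simp: space_pair_measure space_PiM PiE_def Pi_def)
      then show "p \<in> A 0 \<times> (\<Pi>\<^sub>E i\<in>{..<k}. A (Suc i))"
        using p(3)[of 0] p(3)[of "Suc _"] by (auto simp: PiE_def Pi_def)
    next
      fix p assume "p \<in> A 0 \<times> (\<Pi>\<^sub>E i\<in>{..<k}. A (Suc i))"
      then show "p \<in> ?c -` Pi\<^sub>E {..<Suc k} A \<inter> space (lborel \<Otimes>\<^sub>M lborel_pow k)"
        by (auto simp: space_pair_measure space_PiM PiE_def Pi_def split: nat.split)
    qed
    then have "emeasure (distr (lborel \<Otimes>\<^sub>M lborel_pow k) (lborel_pow (Suc k)) ?c) (Pi\<^sub>E {..<Suc k} A)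
        = emeasure (lborel \<Otimes>\<^sub>M lborel_pow k) (A 0 \<times> (\<Pi>\<^sub>E i\<in>{..<k}. A (Suc i)))"
      using A by (subst emeasure_distr[OF measurable_cons_lborel_pow]) (auto intro!: sets_PiM_I_finite)
    also have "\<dots> = emeasure lborel (A 0) * (\<Prod>i<k. emeasure lborel (A (Suc i)))"
      using A by (subst K.emeasure_pair_measure_Times) (auto intro!: sets_PiM_I_finite arg_cong2[where f = times] K.measure_times)
    also have "\<dots> = (\<Prod>i<Suc k. emeasure lborel (A i))"
      by (simp add: prod.lessThan_Suc_shift del: prod.lessThan_Suc)
    finally show "emeasure (distr (lborel \<Otimes>\<^sub>M lborel_pow k) (lborel_pow (Suc k)) ?c) (Pi\<^sub>E {..<Suc k} A)
        = (\<Prod>i<Suc k. emeasure lborel (A i))" .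
  qed (rule finite_lessThan, rule sets_distr)
qed

text \<open>Tonelli with the new coordinate innermost, so that it can be integrated in closed form
  while the others are held fixed.\<close>

lemma nn_integral_lborel_pow_Suc:
  assumes f: "f \<in> borel_measurable (lborel_pow (Suc k))"
  shows "(\<integral>\<^sup>+x. f x \<partial>lborel_pow (Suc k))
    = (\<integral>\<^sup>+x. \<integral>\<^sup>+t. f (\<lambda>i\<in>{..<Suc k}. case_nat t x i) \<partial>lborel \<partial>lborel_pow k)"
proof -
  interpret L: product_sigma_finite "\<lambda>_::nat. lborel :: real measure"
    by (simp add: product_sigma_finite_def sigma_finite_lborel)
  interpret K: finite_product_sigma_finite "\<lambda>_::nat. lborel :: real measure" "{..<k}" by standard auto
  interpret P: pair_sigma_finite "lborel :: real measure" "lborel_pow k" ..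
  have m: "(\<lambda>p. f (case p of (t, x) \<Rightarrow> \<lambda>i\<in>{..<Suc k}. case_nat t x i)) \<in> borel_measurable (lborel \<Otimes>\<^sub>M lborel_pow k)"
    by (rule measurable_compose[OF measurable_cons_lborel_pow f])
  show ?thesis
    by (subst lborel_pow_Suc[symmetric], subst nn_integral_distr[OF measurable_cons_lborel_pow],
        simp add: f, subst P.nn_integral_snd[OF m, symmetric]) simp
qed

section \<open>Conditioning a multivariate normal law on all but one coordinate\<close>

text \<open>As a finite double sum the form comes within reach of the measurability rules.\<close>

lemma scalar_prod_mult_mat_vec_eq_sum:
  assumes "v \<in> carrier_vec n" "A \<in> carrier_mat n n"
  shows "scalar_prod v (A *\<^sub>v Matrix.vec n x) = (\<Sum>i<n. v $ i * (\<Sum>j<n. A $$ (i, j) * x j))"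
  using assms by (simp add: scalar_prod_def atLeast0LessThan)

lemma borel_measurable_scalar_prod:
  fixes v :: "real Matrix.vec"
  assumes "v \<in> carrier_vec n" "A \<in> carrier_mat n n"
    and "\<And>i. i < n \<Longrightarrow> (\<lambda>w. f w i) \<in> borel_measurable M"
  shows "(\<lambda>w. scalar_prod v (A *\<^sub>v Matrix.vec n (f w))) \<in> borel_measurable M"
  unfolding scalar_prod_mult_mat_vec_eq_sum[OF assms(1,2)]
  by (intro borel_measurable_sum borel_measurable_times borel_measurable_const assms(3)) auto

lemma borel_measurable_mvn_density:
  assumes "positive_definite_mat n A"
  shows "mvn_density n A \<in> borel_measurable (lborel_pow n)"
proof -
  have c: "inverse_mat A \<in> carrier_mat n n" by (rule positive_definite_inverse(1)[OF assms])
  have "(\<lambda>x. scalar_prod (Matrix.vec n x) (inverse_mat A *\<^sub>v Matrix.vec n x)) \<in> borel_measurable (lborel_pow n)"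
    unfolding scalar_prod_mult_mat_vec_eq_sum[OF vec_carrier c]
    by (intro borel_measurable_sum borel_measurable_times borel_measurable_const)
      (auto intro: measurable_component_lborel_pow)
  then show ?thesis unfolding mvn_density_def by measurable
qed

lemma mvn_density_cong:
  assumes "\<And>i. i < n \<Longrightarrow> x i = y i"
  shows "mvn_density n A x = mvn_density n A y"
proof -
  have "Matrix.vec n x = Matrix.vec n y" using assms by (intro eq_vecI) auto
  then show ?thesis by (simp add: mvn_density_def)
qed

lemma sets_mvn [simp]: "sets (mvn n A) = sets (lborel_pow n)"
  by (simp add: mvn_def)

lemma space_mvn [simp]: "space (mvn n A) = space (lborel_pow n)"
  by (simp add: mvn_def)

context
  fixes k a b S
  assumes b: "b \<in> carrier_vec k" and S: "S \<in> carrier_mat k k"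
    and pd: "positive_definite_mat (Suc k) (bordered_mat a b S)"
begin

text \<open>Disintegration along coordinate 0, whose conditional law is normal: after Tonelli, the
  factor \<open>mvn_density k S x\<close> does not depend on \<open>t\<close> and leaves the inner
  integral, where it turns Lebesgue measure into \<open>mvn k S\<close>.\<close>

lemma nn_integral_mvn_bordered:
  assumes f: "f \<in> borel_measurable (lborel_pow (Suc k))"
  shows "(\<integral>\<^sup>+x. f x \<partial>mvn (Suc k) (bordered_mat a b S))
    = (\<integral>\<^sup>+x. (\<integral>\<^sup>+t. ennreal (normal_density (scalar_prod b (inverse_mat S *\<^sub>v Matrix.vec k x))
          (sqrt (schur_complement a b S)) t) * f (\<lambda>i\<in>{..<Suc k}. case_nat t x i) \<partial>lborel) \<partial>mvn k S)"
proof -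
  let ?c = "\<lambda>t x. \<lambda>i\<in>{..<Suc k}. case_nat t x i :: real"
  let ?\<mu> = "\<lambda>x. scalar_prod b (inverse_mat S *\<^sub>v Matrix.vec k x)" and ?s = "sqrt (schur_complement a b S)"
  have pdS: "positive_definite_mat k S" by (rule positive_definite_bordered_block[OF b S pd])
  note inv = positive_definite_inverse(1)[OF pdS]
  note dm = borel_measurable_mvn_density[OF pd] and dS[measurable] = borel_measurable_mvn_density[OF pdS]
  have \<mu>[measurable]: "?\<mu> \<in> borel_measurable (lborel_pow k)"
    by (intro borel_measurable_scalar_prod[OF b inv] measurable_component_lborel_pow)
  have fc[measurable]: "(\<lambda>(x, t). f (?c t x)) \<in> borel_measurable (lborel_pow k \<Otimes>\<^sub>M lborel)"
    using measurable_compose[OF measurable_compose[OF measurable_pair_swap' measurable_cons_lborel_pow] f]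
    by (simp add: split_beta')
  have dens: "mvn_density (Suc k) (bordered_mat a b S) (?c t x)
      = normal_density (?\<mu> x) ?s t * mvn_density k S x" for t x
  proof -
    have "Matrix.vec k (\<lambda>i. ?c t x (Suc i)) = Matrix.vec k x" by (intro eq_vecI) auto
    moreover have "mvn_density k S (\<lambda>i. ?c t x (Suc i)) = mvn_density k S x" by (rule mvn_density_cong) auto
    ultimately show ?thesis unfolding mvn_density_bordered[OF b S pd] by simp
  qed
  have dS0: "0 \<le> mvn_density k S x" for x
    using positive_definite_det_pos[OF pdS] by (simp add: mvn_density_def)
  have "(\<integral>\<^sup>+x. f x \<partial>mvn (Suc k) (bordered_mat a b S))
      = (\<integral>\<^sup>+x. ennreal (mvn_density (Suc k) (bordered_mat a b S) x) * f x \<partial>lborel_pow (Suc k))"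
    unfolding mvn_def using dm f by (intro nn_integral_density) auto
  also have "\<dots> = (\<integral>\<^sup>+x. \<integral>\<^sup>+t. ennreal (mvn_density k S x) * (ennreal (normal_density (?\<mu> x) ?s t) * f (?c t x)) \<partial>lborel \<partial>lborel_pow k)"
    using dm f dS0 by (subst nn_integral_lborel_pow_Suc) (auto simp: dens ennreal_mult mult_ac)
  also have "\<dots> = (\<integral>\<^sup>+x. ennreal (mvn_density k S x) * (\<integral>\<^sup>+t. ennreal (normal_density (?\<mu> x) ?s t) * f (?c t x) \<partial>lborel) \<partial>lborel_pow k)"
  proof (intro nn_integral_cong nn_integral_cmult borel_measurable_times_ennreal)
    fix x assume x: "x \<in> space (lborel_pow k)"
    show "(\<lambda>t. f (?c t x)) \<in> borel_measurable lborel"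
      using measurable_compose[OF measurable_Pair1'[OF x] fc] by simp
  qed auto
  also have "\<dots> = (\<integral>\<^sup>+x. (\<integral>\<^sup>+t. ennreal (normal_density (?\<mu> x) ?s t) * f (?c t x) \<partial>lborel) \<partial>mvn k S)"
    unfolding mvn_def
  proof (intro nn_integral_density[symmetric])
    have "(\<lambda>(x, t). ennreal (normal_density (?\<mu> x) ?s t) * f (?c t x)) \<in> borel_measurable (lborel_pow k \<Otimes>\<^sub>M lborel)"
      using \<mu> fc unfolding normal_density_def by measurable
    then show "(\<lambda>x. \<integral>\<^sup>+t. ennreal (normal_density (?\<mu> x) ?s t) * f (?c t x) \<partial>lborel) \<in> borel_measurable (lborel_pow k)"
      by (rule lborel.borel_measurable_nn_integral)
  qed simp
  finally show ?thesis .
qed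

lemma emeasure_mvn_bordered_lower_orthant:
  "emeasure (mvn (Suc k) (bordered_mat a b S))
      {x \<in> space (mvn (Suc k) (bordered_mat a b S)). \<forall>i<Suc k. ereal (x i) \<le> e i}
    = (\<integral>\<^sup>+x. ennreal (std_normal_cdf_ext ((e 0 - ereal (scalar_prod b (inverse_mat S *\<^sub>v Matrix.vec k x)))
          / ereal (sqrt (schur_complement a b S)))) * indicator {x. \<forall>i<k. ereal (x i) \<le> e (Suc i)} x \<partial>mvn k S)"
    (is "emeasure ?M ?A = _")
proof -
  let ?c = "\<lambda>t x. \<lambda>i\<in>{..<Suc k}. case_nat t x i :: real"
  let ?\<mu> = "\<lambda>x. scalar_prod b (inverse_mat S *\<^sub>v Matrix.vec k x)" and ?s = "sqrt (schur_complement a b S)"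
  have s: "?s > 0" using schur_complement_pos[OF b S pd] by simp
  have A: "?A \<in> sets (lborel_pow (Suc k))"
  proof -
    note [measurable] = measurable_component_lborel_pow[of _ "Suc k"]
    have "{x \<in> space (lborel_pow (Suc k)). \<forall>i\<in>{..<Suc k}. ereal (x i) \<le> e i} \<in> sets (lborel_pow (Suc k))"
      by measurable
    then show ?thesis by (simp add: Ball_def)
  qed
  \<comment> \<open>The orthant is a product of a ray in coordinate 0 and an orthant in the others;
    the second factor is constant in the inner integral.\<close>
  have ind: "indicator ?A (?c t x) = (indicator {t. ereal t \<le> e 0} t
      * indicator {x. \<forall>i<k. ereal (x i) \<le> e (Suc i)} x :: ennreal)" for t x
    by (auto simp: indicator_def space_PiM PiE_def less_Suc_eq_0_disj)
  have "emeasure ?M ?A = (\<integral>\<^sup>+x. indicator ?A x \<partial>?M)"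
    using A by (intro nn_integral_indicator[symmetric]) simp
  also have "\<dots> = (\<integral>\<^sup>+x. (\<integral>\<^sup>+t. (ennreal (normal_density (?\<mu> x) ?s t) * indicator {t. ereal t \<le> e 0} t)
      * indicator {x. \<forall>i<k. ereal (x i) \<le> e (Suc i)} x \<partial>lborel) \<partial>mvn k S)"
    using A by (subst nn_integral_mvn_bordered) (auto simp only: ind mult.assoc borel_measurable_indicator)
  also have "\<dots> = (\<integral>\<^sup>+x. (\<integral>\<^sup>+t. ennreal (normal_density (?\<mu> x) ?s t) * indicator {t. ereal t \<le> e 0} t \<partial>lborel)
      * indicator {x. \<forall>i<k. ereal (x i) \<le> e (Suc i)} x \<partial>mvn k S)"
  proof (intro nn_integral_cong nn_integral_multc)
    have "{t. ereal t \<le> e 0} \<in> sets borel" by measurable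
    then show "(\<lambda>t. ennreal (normal_density (?\<mu> x) ?s t) * indicator {t. ereal t \<le> e 0} t) \<in> borel_measurable lborel" for x
      by measurable
  qed
  finally show ?thesis by (simp only: nn_integral_normal_density_le[OF s])
qed

end

text \<open>With all bounds infinite the conditional distribution function in the orthant formula is
  1, so the total mass equals that of the law with one coordinate less. In dimension 0 the density
  is 1 on a single point.\<close>

lemma prob_space_mvn: "positive_definite_mat n A \<Longrightarrow> prob_space (mvn n A)"
proof (induction n arbitrary: A)
  case 0
  then have A: "A \<in> carrier_mat 0 0" by (simp add: positive_definite_mat_def)
  have d: "mvn_density 0 A x = 1" for x
    using det_dim_zero[OF A] by (simp add: mvn_density_def scalar_prod_def)
  show ?case
    by (rule prob_spaceI) (simp add: mvn_def PiM_empty emeasure_density d)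
next
  case (Suc k)
  from Suc.prems obtain a b S where A: "b \<in> carrier_vec k" "S \<in> carrier_mat k k" "A = bordered_mat a b S"
    using symmetric_mat_eq_bordered[of A k] unfolding positive_definite_mat_def by metis
  with Suc.prems have pd: "positive_definite_mat (Suc k) (bordered_mat a b S)" by simp
  have s: "sqrt (schur_complement a b S) > 0" using schur_complement_pos[OF A(1,2) pd] by simp
  have "emeasure (mvn (Suc k) A) {x \<in> space (mvn (Suc k) A). \<forall>i<Suc k. ereal (x i) \<le> \<infinity>} = (\<integral>\<^sup>+x. 1 \<partial>mvn k S)"
    unfolding A(3) emeasure_mvn_bordered_lower_orthant[OF A(1,2) pd, of "\<lambda>_. \<infinity>"]
    using s by simp
  also have "\<dots> = 1"
    using prob_space.emeasure_space_1[OF Suc.IH[OF positive_definite_bordered_block[OF A(1,2) pd]]] by simp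
  finally show ?case by (intro prob_spaceI) simp
qed

section \<open>Transport of densities to the copula scale\<close>

context
  fixes D :: "real measure"
  assumes D: "real_distribution D" and cont: "\<And>x. isCont (cdf D) x"
begin

text \<open>The equivalence fails only above \<open>y\<close>, where the distribution function still
  has its value at \<open>y\<close>. Up to a bound \<open>n\<close> the closed set of such points
  with \<open>y\<close> has, by compactness, a largest element \<open>t\<close>, so it lies within
  \<open>{y..t}\<close>, and the mass of \<open>{y<..t}\<close> is a difference of equal values.
  Countably many bounds suffice.\<close>

lemma AE_cdf_le_iff: "AE t in D. cdf D t \<le> cdf D y \<longleftrightarrow> t \<le> y"
proof -
  interpret real_distribution D by (rule D)
  have contD: "continuous_on UNIV (cdf D)" using cont by (simp add: continuous_at_imp_continuous_on)
  have closed: "closed {t. cdf D t \<le> cdf D y}"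
    by (rule closed_Collect_le) (auto intro: contD)
  then have m[measurable]: "{t. cdf D t \<le> cdf D y} \<in> sets borel" by (rule borel_closed)
  have null: "{t. cdf D t \<le> cdf D y} \<inter> {y<..real n} \<in> null_sets D" for n :: nat
  proof (cases "{t. cdf D t \<le> cdf D y} \<inter> {y..real n} = {}")
    case True
    then have "{t. cdf D t \<le> cdf D y} \<inter> {y<..real n} = {}" by force
    then show ?thesis by (simp add: null_sets_def)
  next
    case False
    have "compact ({t. cdf D t \<le> cdf D y} \<inter> {y..real n})" using closed by (intro closed_Int_compact) auto
    from compact_attains_sup[OF this False] obtain t where t: "cdf D t \<le> cdf D y" "y \<le> t"
      and max: "\<And>t'. cdf D t' \<le> cdf D y \<Longrightarrow> y \<le> t' \<Longrightarrow> t' \<le> real n \<Longrightarrow> t' \<le> t" by auto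
    have "cdf D t = cdf D y" using t cdf_nondecreasing[OF t(2)] by simp
    then have "emeasure D {y<..t} = 0" using emeasure_Ioc[OF t(2)] by simp
    then have "{y<..t} \<in> null_sets D" by (simp add: null_sets_def)
    then show ?thesis by (rule null_sets_subset) (use max in auto)
  qed
  have "(\<Union>n. {t. cdf D t \<le> cdf D y} \<inter> {y<..real n}) \<in> null_sets D"
    using null by (intro null_sets_UN) auto
  then show ?thesis
  proof (rule AE_I')
    show "{t \<in> space D. \<not> (cdf D t \<le> cdf D y \<longleftrightarrow> t \<le> y)} \<subseteq> (\<Union>n. {t. cdf D t \<le> cdf D y} \<inter> {y<..real n})"
    proof
      fix t assume t: "t \<in> {t \<in> space D. \<not> (cdf D t \<le> cdf D y \<longleftrightarrow> t \<le> y)}"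
      then have "y < t" "cdf D t \<le> cdf D y" using cdf_nondecreasing[of t y] by (auto simp: not_le)
      moreover obtain n :: nat where "t \<le> real n" using real_arch_simple by blast
      ultimately show "t \<in> (\<Union>n. {t. cdf D t \<le> cdf D y} \<inter> {y<..real n})" by auto
    qed
  qed
qed

lemma distr_cdf_uniform: "distr D borel (cdf D) = density lborel (indicator {0<..<1})"
proof -
  interpret real_distribution D by (rule D)
  have contD: "continuous_on UNIV (cdf D)" using cont by (simp add: continuous_at_imp_continuous_on)
  then have mD[measurable]: "cdf D \<in> borel_measurable D" by (simp add: borel_measurable_continuous_onI)
  let ?U = "density lborel (indicator {0<..<1} :: real \<Rightarrow> ennreal)"
  have "prob_space ?U" by (intro prob_spaceI) (simp add: emeasure_density)
  then have U: "real_distribution ?U" by (simp add: real_distribution_def real_distribution_axioms_def)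
  have att: "measure D {t. cdf D t \<le> cdf D y} = cdf D y" for y
  proof (rule trans[OF finite_measure_eq_AE cdf_def2[symmetric]])
    show "AE t in D. t \<in> {t. cdf D t \<le> cdf D y} \<longleftrightarrow> t \<in> {..y}" using AE_cdf_le_iff[of y] by simp
    show "{t. cdf D t \<le> cdf D y} \<in> sets D"
      using borel_closed[OF closed_Collect_le[OF contD continuous_on_const]] by simp
  qed simp
  have "measure D {t. cdf D t \<le> u} = measure lborel ({0<..<1} \<inter> {..u})" for u
  proof -
    \<comment> \<open>All levels strictly between 0 and 1 are attained. Level 0 may or may not be: a
      law on the positive half-line attains it, the normal law does not.\<close>
    consider "u < 0" | "u = 0" "{t. cdf D t \<le> 0} = {}" | "u = 0" "\<exists>y. cdf D y = u" | "0 < u" "u < 1" | "1 \<le> u"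
    proof -
      have "{t. cdf D t \<le> 0} = {} \<or> (\<exists>y. cdf D y = 0)"
        using cdf_nonneg by (auto intro: antisym)
      then show thesis using that by (cases "u < 0"; cases "u = 0"; cases "u < 1") auto
    qed
    then show ?thesis
    proof cases
      case 1
      have "u < cdf D t" for t using 1 cdf_nonneg[of t] by linarith
      then have "{t. cdf D t \<le> u} = {}" by (simp add: not_le)
      moreover have "{0<..<1} \<inter> {..u} = {}" using 1 by auto
      ultimately show ?thesis by simp
    next
      case 2
      then have "{0<..<1} \<inter> {..u} = {}" by auto
      with 2 show ?thesis by simp
    next
      case 3
      then have "{0<..<1} \<inter> {..u} = {}" by auto
      moreover obtain y where "cdf D y = u" using 3 by blast
      ultimately show ?thesis using att[of y] 3(1) by simp
    next
      case 4
      then have "{0<..<1} \<inter> {..u} = {0<..u}" by auto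
      moreover obtain y where "cdf D y = u" using real_distribution_cdf_attains[OF D cont 4] by auto
      ultimately show ?thesis using att[of y] 4 by simp
    next
      case 5
      then have "{t. cdf D t \<le> u} = UNIV" "{0<..<1} \<inter> {..u} = {0<..<1}"
        using order_trans[OF cdf_bounded_prob 5] 5 by auto
      then show ?thesis using prob_space by simp
    qed
  qed
  moreover have "emeasure ?U {..u} = emeasure lborel ({0<..<1} \<inter> {..u})" for u
    by (subst emeasure_density) (simp_all add: indicator_inter_arith[symmetric])
  ultimately have "cdf (distr D borel (cdf D)) u = cdf ?U u" for u
    unfolding cdf_def2[of "distr D borel (cdf D)"] cdf_def2[of ?U]
    using mD by (subst measure_distr) (simp_all add: vimage_def measure_def)
  then show ?thesis
    by (intro cdf_unique U real_distribution_distr mD ext)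
qed

end

section \<open>Images of the severity product law and of the normal law on the unit cube\<close>

lemma sets_open_unit_cube: "open_unit_cube n \<in> sets (lborel_pow n)"
  by (rule sets_PiM_I_finite) auto

text \<open>The independent product law is only a reference measure, since the severities of the
  model are dependent. Their dependence enters through the copula density, which is relative to the
  uniform law obtained here.\<close>

lemma distr_severity_cdf_cube:
  assumes f: "f \<in> borel_measurable borel" and D: "real_distribution (density lborel f)"
    and cont: "\<And>x. isCont (cdf (density lborel f)) x"
  shows "distr (density (lborel_pow n) (\<lambda>t. \<Prod>i<n. f (t i))) (lborel_pow n)
      (\<lambda>t. \<lambda>i\<in>{..<n}. cdf (density lborel f) (t i))
    = density (lborel_pow n) (indicator (open_unit_cube n))"
proof -
  let ?F = "cdf (density lborel f)" and ?U = "density lborel (indicator {0<..<1} :: real \<Rightarrow> ennreal)"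
  interpret D: real_distribution "density lborel f" by (rule D)
  have pU: "prob_space ?U" by (intro prob_spaceI) (simp add: emeasure_density)
  have F: "?F \<in> borel_measurable borel"
    using cont by (intro borel_measurable_continuous_onI continuous_at_imp_continuous_on) auto
  \<comment> \<open>The target is \<open>?U\<close> rather than \<open>borel\<close> because a
    probability space is required; \<open>distr\<close> depends only on its measurable sets.\<close>
  have "distr (PiM {..<n} (\<lambda>_. density lborel f)) (PiM {..<n} (\<lambda>_. ?U)) (compose {..<n} ?F)
      = PiM {..<n} (\<lambda>_. distr (density lborel f) ?U ?F)"
    using F by (intro distr_PiM_finite_prob_space' pU) (auto intro: D.prob_space_axioms)
  also have "distr (density lborel f) ?U ?F = distr (density lborel f) borel ?F"
    by (intro distr_cong) auto
  also have "\<dots> = ?U" by (rule distr_cdf_uniform[OF D cont])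
  also have "PiM {..<n} (\<lambda>_. ?U) = density (lborel_pow n) (\<lambda>x. \<Prod>i<n. indicator {0<..<1} (x i))"
    using pU by (intro PiM_density_lborel) (auto intro: finite_measure.axioms(1) prob_space.finite_measure)
  also have "\<dots> = density (lborel_pow n) (indicator (open_unit_cube n))"
  proof (intro density_cong AE_I2)
    have [measurable]: "(\<lambda>x. x i) \<in> borel_measurable (lborel_pow n)" if "i < n" for i
      using that by (rule measurable_component_lborel_pow)
    show "(\<lambda>x. \<Prod>i<n. indicator {0<..<1} (x i) :: ennreal) \<in> borel_measurable (lborel_pow n)" by measurable
    show "indicator (open_unit_cube n) \<in> borel_measurable (lborel_pow n)"
      using sets_open_unit_cube by simp
    fix x assume "x \<in> space (lborel_pow n)"
    then show "(\<Prod>i<n. indicator {0<..<1} (x i) :: ennreal) = indicator (open_unit_cube n) x"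
      by (auto simp: indicator_def space_PiM PiE_def Pi_def intro!: prod.neutral)
  qed
  finally have "distr (PiM {..<n} (\<lambda>_. density lborel f)) (PiM {..<n} (\<lambda>_. ?U)) (compose {..<n} ?F)
      = density (lborel_pow n) (indicator (open_unit_cube n))" .
  moreover have "PiM {..<n} (\<lambda>_. density lborel f) = density (lborel_pow n) (\<lambda>t. \<Prod>i<n. f (t i))"
    by (intro PiM_density_lborel f) (auto intro: finite_measure.axioms(1) prob_space.finite_measure D.prob_space_axioms)
  moreover have "sets (PiM {..<n} (\<lambda>_. ?U)) = sets (lborel_pow n)" by (intro sets_PiM_cong) auto
  ultimately show ?thesis
    by (simp add: compose_def cong: distr_cong)
qed

text \<open>\<open>c\<close> is arbitrary outside the cube, so measurability is available only
  together with the indicator.\<close>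

lemma borel_measurable_copula_density:
  assumes c: "is_copula_density n C c"
  shows "(\<lambda>v. indicator (open_unit_cube n) v * ennreal (c v)) \<in> borel_measurable (lborel_pow n)"
proof -
  have "(\<lambda>v. ennreal (indicator (open_unit_cube n) v *\<^sub>R c v)) \<in> borel_measurable (lborel_pow n)"
    using c unfolding is_copula_density_def set_borel_measurable_def by (intro measurable_compose[OF _ measurable_ennreal]) blast
  moreover have "ennreal (indicator (open_unit_cube n) v *\<^sub>R c v) = indicator (open_unit_cube n) v * ennreal (c v)" for v
    by (auto simp: indicator_def)
  ultimately show ?thesis by simp
qed

text \<open>Pulled back along \<Phi>, a lower box becomes an orthant bounded by quantiles, whose
  mass is by definition the copula. Lower boxes determine the law.\<close>

lemma distr_mvn_copula_density:
  assumes pd: "positive_definite_mat n S" and c: "is_copula_density n (gaussian_copula n S) c"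
  shows "distr (mvn n S) (lborel_pow n) (\<lambda>x. \<lambda>i\<in>{..<n}. std_normal_cdf (x i))
    = density (lborel_pow n) (\<lambda>v. indicator (open_unit_cube n) v * ennreal (c v))"
proof -
  interpret P: prob_space "mvn n S" by (rule prob_space_mvn[OF pd])
  note [measurable] = measurable_component_lborel_pow[of _ n]
  let ?T = "\<lambda>x. \<lambda>i\<in>{..<n}. std_normal_cdf (x i)"
  have T: "?T \<in> measurable (mvn n S) (lborel_pow n)"
    by (intro measurable_restrict) (auto simp: measurable_cong_sets[OF sets_mvn refl])
  note cm = borel_measurable_copula_density[OF c]
  show ?thesis
  proof (rule measure_eqI_lower_boxes[where n = n])
    show "finite_measure (distr (mvn n S) (lborel_pow n) ?T)"
      by (intro prob_space.finite_measure P.prob_space_distr T)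
    fix y :: "nat \<Rightarrow> real"
    \<comment> \<open>The defining property of a copula density concerns corners in the closed unit
      cube only. Clipping a corner changes no inequality for values strictly between 0 and
      1.\<close>
    define u where "u = (\<lambda>i\<in>{..<n}. max 0 (min 1 (y i)))"
    have u: "u \<in> PiE {..<n} (\<lambda>_. {0..1})" by (auto simp: u_def)
    have "emeasure (distr (mvn n S) (lborel_pow n) ?T) {x \<in> space (lborel_pow n). \<forall>i<n. x i \<le> y i}
        = emeasure (mvn n S) (?T -` {x \<in> space (lborel_pow n). \<forall>i<n. x i \<le> y i} \<inter> space (mvn n S))"
      by (rule emeasure_distr[OF T sets_lower_box])
    also have "?T -` {x \<in> space (lborel_pow n). \<forall>i<n. x i \<le> y i} \<inter> space (mvn n S)
        = {x \<in> space (mvn n S). \<forall>i<n. ereal (x i) \<le> std_normal_quantile (u i)}"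
    proof -
      have "std_normal_cdf t \<le> y i \<longleftrightarrow> std_normal_cdf t \<le> u i" if "i < n" for i t
        using std_normal_cdf_bounds[of t] that by (auto simp: u_def max_def min_def)
      then show ?thesis by (auto simp: le_std_normal_quantile_iff space_PiM)
    qed
    also have "emeasure (mvn n S) \<dots> = ennreal (gaussian_copula n S u)"
      by (simp add: P.emeasure_eq_measure gaussian_copula_def)
    also have "\<dots> = (\<integral>\<^sup>+ v \<in> {v \<in> open_unit_cube n. \<forall>i<n. v i \<le> u i}. ennreal (c v) \<partial>lborel_pow n)"
      using c u by (simp add: is_copula_density_def)
    also have "\<dots> = (\<integral>\<^sup>+ v. (indicator (open_unit_cube n) v * ennreal (c v))
        * indicator {x \<in> space (lborel_pow n). \<forall>i<n. x i \<le> y i} v \<partial>lborel_pow n)"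
    proof (intro nn_integral_cong)
      fix v assume "v \<in> space (lborel_pow n)"
      have "v i \<le> u i \<longleftrightarrow> v i \<le> y i" if "v \<in> open_unit_cube n" "i < n" for i
      proof -
        have "v i \<in> {0<..<1}" using that by (auto simp: PiE_def Pi_def)
        then show ?thesis using that by (auto simp: u_def max_def min_def)
      qed
      then show "ennreal (c v) * indicator {v \<in> open_unit_cube n. \<forall>i<n. v i \<le> u i} v
          = (indicator (open_unit_cube n) v * ennreal (c v)) * indicator {x \<in> space (lborel_pow n). \<forall>i<n. x i \<le> y i} v"
        using \<open>v \<in> space (lborel_pow n)\<close> by (auto simp: indicator_def)
    qed
    also have "\<dots> = emeasure (density (lborel_pow n) (\<lambda>v. indicator (open_unit_cube n) v * ennreal (c v)))
        {x \<in> space (lborel_pow n). \<forall>i<n. x i \<le> y i}"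
      by (rule emeasure_density[OF cm sets_lower_box, symmetric])
    finally show "emeasure (distr (mvn n S) (lborel_pow n) ?T) {x \<in> space (distr (mvn n S) (lborel_pow n) ?T). \<forall>i<n. x i \<le> y i}
        = emeasure (density (lborel_pow n) (\<lambda>v. indicator (open_unit_cube n) v * ennreal (c v)))
            {x \<in> space (distr (mvn n S) (lborel_pow n) ?T). \<forall>i<n. x i \<le> y i}"
      unfolding space_distr .
  qed (simp_all add: sets_lborel_pow)
qed

section \<open>Joint law of the claim count and the severities\<close>

lemma borel_measurable_std_normal_cdf_ext_affine [measurable (raw)]:
  assumes \<mu>: "\<mu> \<in> borel_measurable M" and \<sigma>: "\<sigma> > 0"
  shows "(\<lambda>w. std_normal_cdf_ext ((e - ereal (\<mu> w)) / ereal \<sigma>)) \<in> borel_measurable M"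
proof (cases e)
  case (real a)
  note \<mu>[measurable]
  have "std_normal_cdf_ext ((e - ereal (\<mu> w)) / ereal \<sigma>) = std_normal_cdf ((a - \<mu> w) / \<sigma>)" for w
    using \<sigma> by (simp only: real std_normal_cdf_ext_ereal[symmetric]) simp
  then show ?thesis by simp
qed (use \<sigma> in simp_all)

text \<open>The left-hand side is carried over to the copula scale by the normal distribution function and
  from there to the severity scale by \<^term>\<open>F\<close>. As \<^term>\<open>F\<close> may be constant on intervals,
  \<^term>\<open>F (t i) \<le> F (y i)\<close> and \<^term>\<open>t i \<le> y i\<close> agree only almost everywhere.\<close>

lemma nn_integral_mvn_severity:
  assumes pd: "positive_definite_mat n S" and c: "is_copula_density n (gaussian_copula n S) c"
    and f[measurable]: "f \<in> borel_measurable borel" and D: "real_distribution (density lborel f)"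
    and cont: "\<And>x. isCont (cdf (density lborel f)) x"
    and F: "F = cdf (density lborel f)"
    and g: "g \<in> borel_measurable (lborel_pow n)"
  shows "(\<integral>\<^sup>+x. g x * indicator {x. \<forall>i<n. std_normal_cdf (x i) \<le> F (y i)} x \<partial>mvn n S)
    = (\<integral>\<^sup>+t. indicator (open_unit_cube n) (\<lambda>i\<in>{..<n}. F (t i)) * ennreal (c (\<lambda>i\<in>{..<n}. F (t i))) * (\<Prod>i<n. f (t i))
          * g (\<lambda>i\<in>{..<n}. real_of_ereal (std_normal_quantile (F (t i)))) * indicator {t. \<forall>i<n. t i \<le> y i} t \<partial>lborel_pow n)"
proof -
  interpret P: prob_space "mvn n S" by (rule prob_space_mvn[OF pd])
  interpret D: real_distribution "density lborel f" by (rule D)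
  have comp[measurable]: "(\<lambda>x. x i) \<in> borel_measurable (lborel_pow n)" if "i < n" for i
    using that by (rule measurable_component_lborel_pow)
  have Fm[measurable]: "F \<in> borel_measurable borel"
    unfolding F using cont by (intro borel_measurable_continuous_onI continuous_at_imp_continuous_on) auto
  let ?T = "\<lambda>x. \<lambda>i\<in>{..<n}. std_normal_cdf (x i)" and ?Q = "\<lambda>v. \<lambda>i\<in>{..<n}. real_of_ereal (std_normal_quantile (v i))"
  let ?F = "\<lambda>t. \<lambda>i\<in>{..<n}. F (t i)"
  have T: "?T \<in> measurable (mvn n S) (lborel_pow n)"
    by (intro measurable_restrict) (auto simp: measurable_cong_sets[OF sets_mvn refl])
  have Q: "?Q \<in> measurable (lborel_pow n) (lborel_pow n)"
    by (intro measurable_restrict) auto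
  have FF: "?F \<in> measurable (lborel_pow n) (lborel_pow n)"
    by (intro measurable_restrict) auto
  define c' where "c' = (\<lambda>v. indicator (open_unit_cube n) v * ennreal (c v))"
  \<comment> \<open>On the cube \<open>?Q\<close> turns uniform scores back into normal ones. A
    coordinate outside the open unit interval gets the default 0 from \<open>real_of_ereal\<close>,
    but there \<open>c'\<close> vanishes.\<close>
  define G where "G = (\<lambda>v. g (?Q v) * indicator {v \<in> space (lborel_pow n). \<forall>i<n. v i \<le> F (y i)} v)"
  have c'[measurable]: "c' \<in> borel_measurable (lborel_pow n)"
    unfolding c'_def by (rule borel_measurable_copula_density[OF c])
  have G[measurable]: "G \<in> borel_measurable (lborel_pow n)"
    unfolding G_def using measurable_compose[OF Q g] sets_lower_box[of n "\<lambda>i. F (y i)"] by simp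
  have cube: "indicator (open_unit_cube n) \<in> borel_measurable (lborel_pow n)"
    using sets_open_unit_cube by simp
  have pf: "(\<lambda>t. \<Prod>i<n. f (t i)) \<in> borel_measurable (lborel_pow n)" by measurable
  have "(\<integral>\<^sup>+x. g x * indicator {x. \<forall>i<n. std_normal_cdf (x i) \<le> F (y i)} x \<partial>mvn n S) = (\<integral>\<^sup>+x. G (?T x) \<partial>mvn n S)"
  proof (intro nn_integral_cong)
    fix x assume "x \<in> space (mvn n S)"
    \<comment> \<open>This is an equality of functions because points of the space are
      extensional.\<close>
    then have "?Q (?T x) = x" by (auto simp: space_PiM PiE_def extensional_def fun_eq_iff)
    then show "g x * indicator {x. \<forall>i<n. std_normal_cdf (x i) \<le> F (y i)} x = G (?T x)"
      by (auto simp: G_def indicator_def space_PiM)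
  qed
  also have "\<dots> = (\<integral>\<^sup>+v. G v \<partial>distr (mvn n S) (lborel_pow n) ?T)"
    by (intro nn_integral_distr[symmetric] T) simp
  also have "\<dots> = (\<integral>\<^sup>+v. c' v * G v \<partial>lborel_pow n)"
    unfolding distr_mvn_copula_density[OF pd c] c'_def[symmetric] by (intro nn_integral_density c' G)
  \<comment> \<open>\<open>c'\<close> already contains the cube indicator, so a second copy changes
    nothing. It turns Lebesgue measure into the uniform law on the cube, which is an image of the
    severity product law.\<close>
  also have "\<dots> = (\<integral>\<^sup>+v. indicator (open_unit_cube n) v * (c' v * G v) \<partial>lborel_pow n)"
    by (intro nn_integral_cong) (auto simp: c'_def indicator_def)
  also have "\<dots> = (\<integral>\<^sup>+v. c' v * G v \<partial>density (lborel_pow n) (indicator (open_unit_cube n)))"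
    by (intro nn_integral_density[symmetric] cube) measurable
  also have "\<dots> = (\<integral>\<^sup>+v. c' v * G v \<partial>distr (density (lborel_pow n) (\<lambda>t. \<Prod>i<n. f (t i))) (lborel_pow n) ?F)"
    unfolding F distr_severity_cdf_cube[OF f D cont] ..
  also have "\<dots> = (\<integral>\<^sup>+t. c' (?F t) * G (?F t) \<partial>density (lborel_pow n) (\<lambda>t. \<Prod>i<n. f (t i)))"
    using FF by (intro nn_integral_distr) (auto simp: measurable_cong_sets[OF sets_density refl])
  also have "\<dots> = (\<integral>\<^sup>+t. c' (?F t) * (g (?Q (?F t)) * indicator {t \<in> space (lborel_pow n). \<forall>i<n. t i \<le> y i} t)
      \<partial>density (lborel_pow n) (\<lambda>t. \<Prod>i<n. f (t i)))"
  proof (rule nn_integral_cong_AE)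
    have PiM: "PiM {..<n} (\<lambda>_. density lborel f) = density (lborel_pow n) (\<lambda>t. \<Prod>i<n. f (t i))"
      by (intro PiM_density_lborel f) (auto intro: finite_measure.axioms(1) prob_space.finite_measure D.prob_space_axioms)
    have "AE t in PiM {..<n} (\<lambda>_. density lborel f). \<forall>i\<in>{..<n}. F (t i) \<le> F (y i) \<longleftrightarrow> t i \<le> y i"
      unfolding F by (intro AE_finite_allI AE_PiM_component AE_cdf_le_iff[OF D cont] D.prob_space_axioms) auto
    moreover have "AE t in PiM {..<n} (\<lambda>_. density lborel f). t \<in> space (lborel_pow n)"
      using AE_space[of "PiM {..<n} (\<lambda>_. density lborel f)"] by (simp add: space_PiM)
    ultimately show "AE t in density (lborel_pow n) (\<lambda>t. \<Prod>i<n. f (t i)). c' (?F t) * G (?F t)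
        = c' (?F t) * (g (?Q (?F t)) * indicator {t \<in> space (lborel_pow n). \<forall>i<n. t i \<le> y i} t)"
      unfolding PiM by eventually_elim (auto simp: G_def indicator_def space_PiM)
  qed
  also have "\<dots> = (\<integral>\<^sup>+t. (\<Prod>i<n. f (t i)) * (c' (?F t) * (g (?Q (?F t)) * indicator {t \<in> space (lborel_pow n). \<forall>i<n. t i \<le> y i} t))
      \<partial>lborel_pow n)"
    using measurable_compose[OF FF c'] measurable_compose[OF FF measurable_compose[OF Q g]] sets_lower_box[of n y]
    by (intro nn_integral_density pf) simp
  also have "\<dots> = (\<integral>\<^sup>+t. indicator (open_unit_cube n) (?F t) * ennreal (c (?F t)) * (\<Prod>i<n. f (t i))
          * g (\<lambda>i\<in>{..<n}. real_of_ereal (std_normal_quantile (F (t i)))) * indicator {t. \<forall>i<n. t i \<le> y i} t \<partial>lborel_pow n)"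
  proof (intro nn_integral_cong)
    fix t assume "t \<in> space (lborel_pow n)"
    moreover have "?Q (?F t) = (\<lambda>i\<in>{..<n}. real_of_ereal (std_normal_quantile (F (t i))))" by auto
    ultimately show "(\<Prod>i<n. f (t i)) * (c' (?F t) * (g (?Q (?F t)) * indicator {t \<in> space (lborel_pow n). \<forall>i<n. t i \<le> y i} t))
      = indicator (open_unit_cube n) (?F t) * ennreal (c (?F t)) * (\<Prod>i<n. f (t i))
          * g (\<lambda>i\<in>{..<n}. real_of_ereal (std_normal_quantile (F (t i)))) * indicator {t. \<forall>i<n. t i \<le> y i} t"
      by (simp add: c'_def indicator_def mult_ac)
  qed
  finally show ?thesis .
qed

lemma joint_corr_eq_bordered:
  assumes "severity_corr z \<rho>2 k \<in> carrier_mat k k"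
  shows "joint_corr z \<rho>1 \<rho>2 k = bordered_mat 1 (\<rho>1 \<cdot>\<^sub>v ones_vec k) (severity_corr z \<rho>2 k)"
proof -
  have "1\<^sub>m 1 = Matrix.mat 1 1 (\<lambda>_. 1 :: real)"
    "Matrix.mat 1 k (\<lambda>_. \<rho>1) = Matrix.mat 1 k (\<lambda>(i, j). (\<rho>1 \<cdot>\<^sub>v ones_vec k) $ j)"
    "Matrix.mat k 1 (\<lambda>_. \<rho>1) = Matrix.mat k 1 (\<lambda>(i, j). (\<rho>1 \<cdot>\<^sub>v ones_vec k) $ i)"
    by (auto intro!: eq_matI)
  then show ?thesis by (simp add: joint_corr_def bordered_mat_def)
qed

text \<open>Conditional normality of the count score, given the severities, yields the mass of each
  count as a difference of conditional distribution functions. Monotonicity of \<open>F1\<close>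
  makes this difference nonnegative, so \<open>ennreal\<close> does not truncate it.\<close>

lemma emeasure_claim_count_severities:
  fixes M :: "'a measure" and Nplus :: "'a \<Rightarrow> nat" and Y :: "nat \<Rightarrow> 'a \<Rightarrow> real"
  assumes "prob_space M" and n: "n \<ge> 1"
    and pdS: "positive_definite_mat n (severity_corr z \<rho>2 n)"
    and pdJ: "positive_definite_mat (Suc n) (joint_corr z \<rho>1 \<rho>2 n)"
    and N[measurable]: "Nplus \<in> measurable M (count_space UNIV)"
    and F1: "mono F1" and sev: "is_severity_distribution F2 f2"
    and Y[measurable]: "\<And>i. Y i \<in> borel_measurable M"
    and joint: "\<And>m y. measure M {\<omega> \<in> space M. Nplus \<omega> \<le> m \<and> (\<forall>i<n. Y i \<omega> \<le> y i)}
             = gaussian_copula (Suc n) (joint_corr z \<rho>1 \<rho>2 n) (case_nat (F1 (real m)) (\<lambda>i. F2 (y i)))"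
    and c: "is_copula_density n (gaussian_copula n (severity_corr z \<rho>2 n)) c"
    and B: "B \<in> sets (PiM {..<n} (\<lambda>_. borel))"
  shows "emeasure M {\<omega> \<in> space M. Nplus \<omega> = n \<and> (\<lambda>i\<in>{..<n}. Y i \<omega>) \<in> B}
    = (\<integral>\<^sup>+t\<in>B. indicator (open_unit_cube n) (\<lambda>i\<in>{..<n}. F2 (t i)) * ennreal (c (\<lambda>i\<in>{..<n}. F2 (t i)))
        * (\<Prod>i<n. ennreal (f2 (t i)))
        * ennreal (std_normal_cdf_ext ((std_normal_quantile (F1 (real n)) - ereal (cond_mean z \<rho>1 \<rho>2 F2 n t)) / ereal (cond_sd z \<rho>1 \<rho>2 n))
           - std_normal_cdf_ext ((std_normal_quantile (F1 (real n - 1)) - ereal (cond_mean z \<rho>1 \<rho>2 F2 n t)) / ereal (cond_sd z \<rho>1 \<rho>2 n)))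
        \<partial>lborel_pow n)"
proof -
  interpret prob_space M by fact
  let ?S = "severity_corr z \<rho>2 n" and ?b = "\<rho>1 \<cdot>\<^sub>v ones_vec n"
  have S: "?S \<in> carrier_mat n n" and b: "?b \<in> carrier_vec n" using pdS by (auto simp: positive_definite_mat_def)
  have pd: "positive_definite_mat (Suc n) (bordered_mat 1 ?b ?S)" using pdJ by (simp add: joint_corr_eq_bordered[OF S])
  have sd: "sqrt (schur_complement 1 ?b ?S) = cond_sd z \<rho>1 \<rho>2 n"
    unfolding cond_sd_def schur_complement_def ..
  have sd0: "cond_sd z \<rho>1 \<rho>2 n > 0" using schur_complement_pos[OF b S pd] by (simp only: sd[symmetric] real_sqrt_gt_zero)
  interpret P: prob_space "mvn n ?S" by (rule prob_space_mvn[OF pdS])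
  interpret J: prob_space "mvn (Suc n) (bordered_mat 1 ?b ?S)" by (rule prob_space_mvn[OF pd])
  let ?D = "density lborel (\<lambda>y. ennreal (f2 y))"
  have f2[measurable]: "f2 \<in> borel_measurable borel" and F2: "F2 = cdf ?D"
    using sev by (auto simp: is_severity_distribution_def)
  have D: "real_distribution ?D"
    using sev by (simp add: is_severity_distribution_def real_distribution_def real_distribution_axioms_def)
  have "continuous_on UNIV (cdf ?D)" using sev unfolding is_severity_distribution_def by auto
  then have cont: "isCont (cdf ?D) x" for x by (simp add: continuous_on_eq_continuous_at)
  let ?\<mu> = "\<lambda>x. scalar_prod ?b (inverse_mat ?S *\<^sub>v Matrix.vec n x)"
  \<comment> \<open>The conditional probability, given the severity scores \<open>x\<close>, that
    the count score is at most the normal quantile of \<open>F1 m\<close>.\<close>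
  define \<gamma> where "\<gamma> m x = std_normal_cdf_ext ((std_normal_quantile (F1 m) - ereal (?\<mu> x)) / ereal (cond_sd z \<rho>1 \<rho>2 n))" for m x
  have \<mu>[measurable]: "?\<mu> \<in> borel_measurable (lborel_pow n)"
    by (intro borel_measurable_scalar_prod[OF b positive_definite_inverse(1)[OF pdS]] measurable_component_lborel_pow)
  have \<gamma>[measurable]: "\<gamma> m \<in> borel_measurable (lborel_pow n)" for m
    unfolding \<gamma>_def by (intro borel_measurable_std_normal_cdf_ext_affine \<mu> sd0)
  have \<gamma>_mono: "\<gamma> m x \<le> \<gamma> m' x" if "m \<le> m'" for m m' x
    unfolding \<gamma>_def using sd0 that F1
    by (intro std_normal_cdf_ext_mono ereal_divide_right_mono ereal_minus_mono std_normal_quantile_mono)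
      (auto simp: mono_def)
  have \<gamma>0: "0 \<le> \<gamma> m x" for m x by (simp add: \<gamma>_def std_normal_cdf_ext_bounds)
  let ?I = "\<lambda>y x. indicator {x. \<forall>i<n. std_normal_cdf (x i) \<le> F2 (y i)} x :: ennreal"
  have boxM: "{\<omega> \<in> space M. P (Nplus \<omega>) \<and> (\<forall>i<n. Y i \<omega> \<le> y i)} \<in> sets M" for y and P :: "nat \<Rightarrow> bool"
  proof -
    have "{\<omega> \<in> space M. P (Nplus \<omega>) \<and> (\<forall>i\<in>{..<n}. Y i \<omega> \<le> y i)} \<in> sets M" by measurable
    then show ?thesis by (simp add: Ball_def)
  qed
  have I[measurable]: "?I y \<in> borel_measurable (lborel_pow n)" for y
  proof -
    note [measurable] = measurable_component_lborel_pow[of _ n]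
    have "{x \<in> space (lborel_pow n). \<forall>i\<in>{..<n}. std_normal_cdf (x i) \<le> F2 (y i)} \<in> sets (lborel_pow n)" by measurable
    then have "indicator {x \<in> space (lborel_pow n). \<forall>i\<in>{..<n}. std_normal_cdf (x i) \<le> F2 (y i)} \<in> borel_measurable (lborel_pow n)"
      by simp
    then show ?thesis by (rule measurable_cong[THEN iffD1, rotated]) (auto simp: indicator_def)
  qed
  have le: "emeasure M {\<omega> \<in> space M. Nplus \<omega> \<le> m \<and> (\<forall>i<n. Y i \<omega> \<le> y i)}
      = (\<integral>\<^sup>+x. ennreal (\<gamma> (real m) x) * ?I y x \<partial>mvn n ?S)" for m y
  proof -
    have "emeasure M {\<omega> \<in> space M. Nplus \<omega> \<le> m \<and> (\<forall>i<n. Y i \<omega> \<le> y i)}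
        = emeasure (mvn (Suc n) (bordered_mat 1 ?b ?S)) {x \<in> space (mvn (Suc n) (bordered_mat 1 ?b ?S)).
            \<forall>i<Suc n. ereal (x i) \<le> std_normal_quantile (case_nat (F1 (real m)) (\<lambda>i. F2 (y i)) i)}"
      unfolding emeasure_eq_measure joint gaussian_copula_def joint_corr_eq_bordered[OF S] J.emeasure_eq_measure ..
    also have "\<dots> = (\<integral>\<^sup>+x. ennreal (\<gamma> (real m) x) * ?I y x \<partial>mvn n ?S)"
      unfolding emeasure_mvn_bordered_lower_orthant[OF b S pd] \<gamma>_def sd by (simp add: le_std_normal_quantile_iff)
    finally show ?thesis .
  qed
  \<comment> \<open>Instead of subtracting integrals, the event for counts up to \<open>n\<close> is
    written as a disjoint union, and the finite mass for counts up to \<open>n - 1\<close> is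
    cancelled.\<close>
  have eq: "emeasure M {\<omega> \<in> space M. Nplus \<omega> = n \<and> (\<forall>i<n. Y i \<omega> \<le> y i)}
      = (\<integral>\<^sup>+x. ennreal (\<gamma> (real n) x - \<gamma> (real (n - 1)) x) * ?I y x \<partial>mvn n ?S)" (is "?L = ?R") for y
  proof -
    let ?A = "{\<omega> \<in> space M. Nplus \<omega> \<le> n - 1 \<and> (\<forall>i<n. Y i \<omega> \<le> y i)}"
    have "?L + emeasure M ?A = emeasure M ({\<omega> \<in> space M. Nplus \<omega> = n \<and> (\<forall>i<n. Y i \<omega> \<le> y i)} \<union> ?A)"
      using n by (intro plus_emeasure boxM) auto
    also have "{\<omega> \<in> space M. Nplus \<omega> = n \<and> (\<forall>i<n. Y i \<omega> \<le> y i)} \<union> ?A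
        = {\<omega> \<in> space M. Nplus \<omega> \<le> n \<and> (\<forall>i<n. Y i \<omega> \<le> y i)}" using n by auto
    also have "emeasure M \<dots> = (\<integral>\<^sup>+x. ennreal (\<gamma> (real n) x - \<gamma> (real (n - 1)) x) * ?I y x
        + ennreal (\<gamma> (real (n - 1)) x) * ?I y x \<partial>mvn n ?S)"
      unfolding le using \<gamma>_mono[of "real (n - 1)" "real n"] \<gamma>0
      by (intro nn_integral_cong) (simp add: distrib_right[symmetric] ennreal_plus[symmetric] del: ennreal_plus)
    also have "\<dots> = ?R + emeasure M ?A"
      unfolding le by (intro nn_integral_add) (simp_all add: measurable_cong_sets[OF sets_mvn refl])
    finally have "emeasure M ?A + ?L = emeasure M ?A + ?R" by (simp only: add.commute)
    then show ?thesis using emeasure_finite[of ?A] unfolding ennreal_add_left_cancel by simp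
  qed
  let ?FY = "\<lambda>t. \<lambda>i\<in>{..<n}. F2 (t i)"
  let ?q = "\<lambda>t. \<lambda>i\<in>{..<n}. real_of_ereal (std_normal_quantile (F2 (t i)))"
  define W where "W t = indicator (open_unit_cube n) (?FY t) * ennreal (c (?FY t)) * (\<Prod>i<n. ennreal (f2 (t i)))
      * ennreal (\<gamma> (real n) (?q t) - \<gamma> (real (n - 1)) (?q t))" for t
  note [measurable] = measurable_component_lborel_pow[of _ n]
  have F2m[measurable]: "F2 \<in> borel_measurable borel"
    unfolding F2 using cont by (intro borel_measurable_continuous_onI continuous_at_imp_continuous_on) auto
  have FY[measurable]: "?FY \<in> measurable (lborel_pow n) (lborel_pow n)" by (intro measurable_restrict) auto
  have q[measurable]: "?q \<in> measurable (lborel_pow n) (lborel_pow n)" by (intro measurable_restrict) auto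
  have W[measurable]: "W \<in> borel_measurable (lborel_pow n)"
    unfolding W_def using measurable_compose[OF FY borel_measurable_copula_density[OF c]] by measurable
  have eqW: "emeasure M {\<omega> \<in> space M. Nplus \<omega> = n \<and> (\<forall>i<n. Y i \<omega> \<le> y i)}
      = (\<integral>\<^sup>+t. W t * indicator {t. \<forall>i<n. t i \<le> y i} t \<partial>lborel_pow n)" for y
    unfolding eq W_def by (rule nn_integral_mvn_severity[OF pdS c _ D cont F2]) measurable
  let ?Yv = "\<lambda>\<omega>. \<lambda>i\<in>{..<n}. Y i \<omega>" and ?N = "{\<omega> \<in> space M. Nplus \<omega> = n}"
  let ?PB = "PiM {..<n} (\<lambda>_. borel :: real measure)"
  \<comment> \<open>Cutting \<open>M\<close> down to the event that the count is \<open>n\<close>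
    gives a finite measure, so the image under the severity vector is determined by its lower
    boxes.\<close>
  let ?M' = "density M (indicator ?N)"
  have Yv: "?Yv \<in> measurable M ?PB" by (intro measurable_restrict) auto
  then have Yv': "?Yv \<in> measurable ?M' ?PB" by simp
  have distr: "emeasure (distr ?M' ?PB ?Yv) A = emeasure M {\<omega> \<in> space M. Nplus \<omega> = n \<and> ?Yv \<omega> \<in> A}" if "A \<in> sets ?PB" for A
  proof -
    have "emeasure (distr ?M' ?PB ?Yv) A = emeasure ?M' (?Yv -` A \<inter> space M)"
      using emeasure_distr[OF Yv' that] by simp
    also have "\<dots> = (\<integral>\<^sup>+\<omega>. indicator ?N \<omega> * indicator (?Yv -` A \<inter> space M) \<omega> \<partial>M)"
      using measurable_sets[OF Yv that] by (intro emeasure_density) auto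
    also have "\<dots> = emeasure M (?N \<inter> (?Yv -` A \<inter> space M))"
      using measurable_sets[OF Yv that] by (simp add: indicator_inter_arith[symmetric])
    also have "?N \<inter> (?Yv -` A \<inter> space M) = {\<omega> \<in> space M. Nplus \<omega> = n \<and> ?Yv \<omega> \<in> A}" by auto
    finally show ?thesis .
  qed
  have "distr ?M' ?PB ?Yv = density (lborel_pow n) W"
  proof (rule measure_eqI_lower_boxes[where n = n])
    show "finite_measure (distr ?M' ?PB ?Yv)"
      using distr[OF sets.top] by (intro finite_measureI) simp
    fix y :: "nat \<Rightarrow> real"
    have box: "{x \<in> space ?PB. \<forall>i<n. x i \<le> y i} \<in> sets ?PB"
      using sets_lower_box[of n y] by (simp add: sets_lborel_pow space_PiM)
    have "{\<omega> \<in> space M. Nplus \<omega> = n \<and> ?Yv \<omega> \<in> {x \<in> space ?PB. \<forall>i<n. x i \<le> y i}}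
        = {\<omega> \<in> space M. Nplus \<omega> = n \<and> (\<forall>i<n. Y i \<omega> \<le> y i)}"
      by (auto simp: space_PiM)
    moreover have "(\<integral>\<^sup>+t. W t * indicator {t. \<forall>i<n. t i \<le> y i} t \<partial>lborel_pow n)
        = (\<integral>\<^sup>+t. W t * indicator {x \<in> space ?PB. \<forall>i<n. x i \<le> y i} t \<partial>lborel_pow n)"
      by (intro nn_integral_cong) (auto simp: indicator_def space_PiM)
    moreover have "\<dots> = emeasure (density (lborel_pow n) W) {x \<in> space ?PB. \<forall>i<n. x i \<le> y i}"
      using box by (intro emeasure_density[symmetric] W) (simp add: sets_lborel_pow)
    ultimately show "emeasure (distr ?M' ?PB ?Yv) {x \<in> space (distr ?M' ?PB ?Yv). \<forall>i<n. x i \<le> y i}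
        = emeasure (density (lborel_pow n) W) {x \<in> space (distr ?M' ?PB ?Yv). \<forall>i<n. x i \<le> y i}"
      unfolding space_distr distr[OF box] by (simp only: eqW)
  qed (simp_all add: sets_lborel_pow)
  then have "emeasure M {\<omega> \<in> space M. Nplus \<omega> = n \<and> ?Yv \<omega> \<in> B} = emeasure (density (lborel_pow n) W) B"
    using distr[OF B] by simp
  also have "\<dots> = (\<integral>\<^sup>+t\<in>B. W t \<partial>lborel_pow n)"
    using B by (intro emeasure_density W) (simp add: sets_lborel_pow)
  also have "W = (\<lambda>t. indicator (open_unit_cube n) (\<lambda>i\<in>{..<n}. F2 (t i)) * ennreal (c (\<lambda>i\<in>{..<n}. F2 (t i)))
        * (\<Prod>i<n. ennreal (f2 (t i)))
        * ennreal (std_normal_cdf_ext ((std_normal_quantile (F1 (real n)) - ereal (cond_mean z \<rho>1 \<rho>2 F2 n t)) / ereal (cond_sd z \<rho>1 \<rho>2 n))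
           - std_normal_cdf_ext ((std_normal_quantile (F1 (real n - 1)) - ereal (cond_mean z \<rho>1 \<rho>2 F2 n t)) / ereal (cond_sd z \<rho>1 \<rho>2 n))))"
  proof -
    have "?\<mu> (?q t) = cond_mean z \<rho>1 \<rho>2 F2 n t" for t
    proof -
      have "Matrix.vec n (?q t) = Matrix.vec n (\<lambda>i. real_of_ereal (std_normal_quantile (F2 (t i))))"
        by (intro eq_vecI) auto
      then show ?thesis by (simp add: cond_mean_def)
    qed
    \<comment> \<open>The subtraction in \<open>nat\<close> is not truncated because
      \<open>n\<close> is positive.\<close>
    moreover have "real (n - 1) = real n - 1" using n by simp
    ultimately show ?thesis unfolding W_def \<gamma>_def by (simp only:)
  qed
  finally show ?thesis .
qed

section \<open>The Bernoulli factor and the atom at zero claims\<close>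

theorem theorem3:
  fixes M :: "'a measure"
    and Nplus N :: "'a \<Rightarrow> nat"
    and Y :: "nat \<Rightarrow> 'a \<Rightarrow> real"
    and R :: "'a \<Rightarrow> bool"
    and z :: nat
    and p \<rho>1 \<rho>2 :: real
    and F1 F2 f2 :: "real \<Rightarrow> real"
    and c :: "nat \<Rightarrow> (nat \<Rightarrow> real) \<Rightarrow> real"
  assumes "prob_space M"
    and "z \<in> {1, 2}"
    and "\<rho>1 \<in> {-1<..<1}" and "\<rho>2 \<in> {-1<..<1}"
    and "z = 1 \<Longrightarrow> \<rho>1\<^sup>2 < \<rho>2 \<and> \<rho>2 < 1"
    and "\<And>k. k \<ge> 1 \<Longrightarrow> positive_definite_mat k (severity_corr z \<rho>2 k)"
    and "\<And>k. k \<ge> 1 \<Longrightarrow> positive_definite_mat (Suc k) (joint_corr z \<rho>1 \<rho>2 k)"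
    and "Nplus \<in> measurable M (count_space UNIV)"
    and "\<And>\<omega>. \<omega> \<in> space M \<Longrightarrow> Nplus \<omega> \<ge> 1"
    and "\<not> (\<exists>m. AE \<omega> in M. Nplus \<omega> = m)"
    and "F1 = cdf (distr M borel (\<lambda>\<omega>. real (Nplus \<omega>)))"
    and "is_severity_distribution F2 f2"
    and "\<And>i. Y i \<in> borel_measurable M"
    and "\<And>k n y. k \<ge> 1 \<Longrightarrow>
           measure M {\<omega> \<in> space M. Nplus \<omega> \<le> n \<and> (\<forall>i<k. Y i \<omega> \<le> y i)}
             = gaussian_copula (Suc k) (joint_corr z \<rho>1 \<rho>2 k)
                 (case_nat (F1 (real n)) (\<lambda>i. F2 (y i)))"
    and "\<And>n. n \<ge> 1 \<Longrightarrow>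
           is_copula_density n (gaussian_copula n (severity_corr z \<rho>2 n)) (c n)"
    and "0 \<le> p" and "p \<le> 1"
    and "R \<in> measurable M (count_space UNIV)"
    and "distr M (count_space UNIV) R = measure_pmf (bernoulli_pmf p)"
    and "\<And>k. k \<ge> 1 \<Longrightarrow>
           indep_rvs M
             (count_space UNIV) R
             (count_space UNIV \<Otimes>\<^sub>M PiM {..<k} (\<lambda>_. borel))
             (\<lambda>\<omega>. (Nplus \<omega>, \<lambda>i\<in>{..<k}. Y i \<omega>))"
    and "\<And>\<omega>. \<omega> \<in> space M \<Longrightarrow> N \<omega> = (if R \<omega> then Nplus \<omega> else 0)"
  shows "is_joint_density M N Y (risk_density z \<rho>1 \<rho>2 p F1 F2 f2 c)"
proof -
  interpret prob_space M by (rule assms(1))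
  let ?h = "risk_density z \<rho>1 \<rho>2 p F1 F2 f2 c"
  note N[measurable] = assms(8) and Y[measurable] = assms(13) and R[measurable] = assms(18)
  have F1: "mono F1"
  proof -
    interpret F: real_distribution "distr M borel (\<lambda>\<omega>. real (Nplus \<omega>))"
      by (rule real_distribution_distr) measurable
    show ?thesis unfolding assms(11) by (intro monoI F.cdf_nondecreasing)
  qed
  let ?D = "density lborel (\<lambda>y. ennreal (f2 y))"
  have f2[measurable]: "f2 \<in> borel_measurable borel" and f20: "0 \<le> f2 y" and F2: "F2 = cdf ?D" for y
    using assms(12) by (auto simp: is_severity_distribution_def)
  interpret D: real_distribution ?D
    using assms(12) by (simp add: is_severity_distribution_def real_distribution_def real_distribution_axioms_def)
  have F2m[measurable]: "F2 \<in> borel_measurable borel"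
    using assms(12) unfolding is_severity_distribution_def by (intro borel_measurable_continuous_onI) blast
  have F2b: "0 \<le> F2 y" "F2 y \<le> 1" for y unfolding F2 by (rule D.cdf_nonneg, rule D.cdf_bounded_prob)
  have R_prob: "prob {\<omega> \<in> space M. R \<omega> = r} = pmf (bernoulli_pmf p) r" for r
  proof -
    have "prob {\<omega> \<in> space M. R \<omega> = r} = measure (distr M (count_space UNIV) R) {r}"
      by (subst measure_distr) (auto intro: arg_cong[where f = prob])
    then show ?thesis by (simp add: assms(19) measure_pmf_single)
  qed
  have zero: "measure M {\<omega> \<in> space M. N \<omega> = 0} = ?h 0 y" for y
  proof -
    \<comment> \<open>The positive count is at least 1, so zero claims can come only from a false
      \<open>R\<close>.\<close>
    have "{\<omega> \<in> space M. N \<omega> = 0} = {\<omega> \<in> space M. R \<omega> = False}"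
      using assms(9,21) by force
    then show ?thesis using R_prob[of False] assms(16,17) by (simp add: risk_density_def)
  qed
  have "?h n \<in> borel_measurable (lborel_pow n) \<and> (\<forall>y \<in> space (lborel_pow n). 0 \<le> ?h n y) \<and>
      (\<forall>B \<in> sets (PiM {..<n} (\<lambda>_. borel)).
         emeasure M {\<omega> \<in> space M. N \<omega> = n \<and> (\<lambda>i\<in>{..<n}. Y i \<omega>) \<in> B}
           = (\<integral>\<^sup>+ y \<in> B. ennreal (?h n y) \<partial>lborel_pow n))" if n: "n \<ge> 1" for n
  proof -
    note pdS = assms(6)[OF n] and pdJ = assms(7)[OF n] and c = assms(15)[OF n]
    let ?S = "severity_corr z \<rho>2 n" and ?b = "\<rho>1 \<cdot>\<^sub>v ones_vec n"
    have S: "?S \<in> carrier_mat n n" and b: "?b \<in> carrier_vec n" using pdS by (auto simp: positive_definite_mat_def)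
    have sd0: "cond_sd z \<rho>1 \<rho>2 n > 0"
      using schur_complement_pos[OF b S, of 1] pdJ
      unfolding cond_sd_def joint_corr_eq_bordered[OF S] schur_complement_def by (simp only: real_sqrt_gt_zero)
    note [measurable] = measurable_component_lborel_pow[of _ n]
    have FY: "(\<lambda>t. \<lambda>i\<in>{..<n}. F2 (t i)) \<in> measurable (lborel_pow n) (lborel_pow n)"
      by (intro measurable_restrict) auto
    define \<delta> where "\<delta> t = std_normal_cdf_ext ((std_normal_quantile (F1 (real n)) - ereal (cond_mean z \<rho>1 \<rho>2 F2 n t)) / ereal (cond_sd z \<rho>1 \<rho>2 n))
           - std_normal_cdf_ext ((std_normal_quantile (F1 (real n - 1)) - ereal (cond_mean z \<rho>1 \<rho>2 F2 n t)) / ereal (cond_sd z \<rho>1 \<rho>2 n))" for t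
    have \<delta>0: "0 \<le> \<delta> t" for t
      unfolding \<delta>_def diff_ge_0_iff_ge using sd0 F1
      by (intro std_normal_cdf_ext_mono ereal_divide_right_mono ereal_minus_mono std_normal_quantile_mono)
        (auto simp: mono_def)
    have mean: "cond_mean z \<rho>1 \<rho>2 F2 n \<in> borel_measurable (lborel_pow n)"
      unfolding cond_mean_def
      by (intro borel_measurable_scalar_prod[OF b positive_definite_inverse(1)[OF pdS]]) measurable
    have \<delta>m: "\<delta> \<in> borel_measurable (lborel_pow n)"
      unfolding \<delta>_def by (intro borel_measurable_diff borel_measurable_std_normal_cdf_ext_affine mean sd0)
    have cube: "(\<lambda>i\<in>{..<n}. F2 (t i)) \<in> open_unit_cube n \<longleftrightarrow> \<not> (\<exists>i<n. F2 (t i) \<in> {0, 1})" for t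
    proof -
      have "F2 x \<in> {0<..<1} \<longleftrightarrow> F2 x \<notin> {0, 1}" for x using F2b[of x] by auto
      then show ?thesis unfolding restrict_PiE_iff by blast
    qed
    \<comment> \<open>As \<open>F2\<close> takes values in the closed unit interval, the exceptional
      case of \<open>risk_density\<close> is exactly the complement of the cube. With the indicator
      as a factor, the known measurability and nonnegativity of \<open>c n\<close> on the cube are
      enough.\<close>
    have h: "?h n t = p * (indicator (open_unit_cube n) (\<lambda>i\<in>{..<n}. F2 (t i)) *\<^sub>R c n (\<lambda>i\<in>{..<n}. F2 (t i))
        * (\<Prod>i<n. f2 (t i)) * \<delta> t)" for t
    proof (cases "\<exists>i<n. F2 (t i) \<in> {0, 1}")
      case True
      then have "indicator (open_unit_cube n) (\<lambda>i\<in>{..<n}. F2 (t i)) = (0 :: real)"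
        using cube[of t] by (simp only: indicator_simps not_True_eq_False not_False_eq_True)
      moreover have "?h n t = 0" using True n unfolding risk_density_def by (simp only: if_True) simp
      ultimately show ?thesis by (simp only: scaleR_zero_left mult_zero_left mult_zero_right)
    next
      case False
      then have "indicator (open_unit_cube n) (\<lambda>i\<in>{..<n}. F2 (t i)) = (1 :: real)"
        using cube[of t] by (simp only: indicator_simps not_False_eq_True)
      moreover have "?h n t = p * severity_density (c) F2 f2 n t * \<delta> t"
        using False n unfolding risk_density_def \<delta>_def by (simp only: if_False) simp
      ultimately show ?thesis by (simp add: severity_density_def)
    qed
    have c0: "0 \<le> indicator (open_unit_cube n) v *\<^sub>R c n v" for v
      using c by (auto simp: is_copula_density_def indicator_def)
    have hm: "?h n \<in> borel_measurable (lborel_pow n)"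
    proof -
      have "(\<lambda>v. indicator (open_unit_cube n) v *\<^sub>R c n v) \<in> borel_measurable (lborel_pow n)"
        using c unfolding is_copula_density_def set_borel_measurable_def by blast
      from measurable_compose[OF FY this] \<delta>m
      have "(\<lambda>t. p * (indicator (open_unit_cube n) (\<lambda>i\<in>{..<n}. F2 (t i)) *\<^sub>R c n (\<lambda>i\<in>{..<n}. F2 (t i))
        * (\<Prod>i<n. f2 (t i)) * \<delta> t)) \<in> borel_measurable (lborel_pow n)"
        by (intro borel_measurable_times borel_measurable_const borel_measurable_prod) auto
      then show ?thesis by (subst h[abs_def])
    qed
    have h0: "0 \<le> ?h n t" for t
      unfolding h using c0 f20 \<delta>0 assms(16) by (intro mult_nonneg_nonneg prod_nonneg) auto
    have hW: "ennreal (?h n t) = ennreal p * (indicator (open_unit_cube n) (\<lambda>i\<in>{..<n}. F2 (t i)) * ennreal (c n (\<lambda>i\<in>{..<n}. F2 (t i)))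
        * (\<Prod>i<n. ennreal (f2 (t i))) * ennreal (\<delta> t))" for t
    proof -
      have "ennreal (indicator (open_unit_cube n) v *\<^sub>R c n v) = indicator (open_unit_cube n) v * ennreal (c n v)" for v
        by (auto simp: indicator_def)
      then show ?thesis unfolding h
        using c0 f20 \<delta>0 assms(16) by (simp only: ennreal_mult mult_nonneg_nonneg prod_nonneg prod_ennreal)
    qed
    have "emeasure M {\<omega> \<in> space M. N \<omega> = n \<and> (\<lambda>i\<in>{..<n}. Y i \<omega>) \<in> B}
           = (\<integral>\<^sup>+ y \<in> B. ennreal (?h n y) \<partial>lborel_pow n)" if B: "B \<in> sets (PiM {..<n} (\<lambda>_. borel))" for B
    proof -
      let ?Z = "\<lambda>\<omega>. (Nplus \<omega>, \<lambda>i\<in>{..<n}. Y i \<omega>)" and ?T = "count_space UNIV \<Otimes>\<^sub>M PiM {..<n} (\<lambda>_. borel :: real measure)"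
      let ?E = "{\<omega> \<in> space M. Nplus \<omega> = n \<and> (\<lambda>i\<in>{..<n}. Y i \<omega>) \<in> B}"
      \<comment> \<open>The event is the preimage of this rectangle under count and severities,
        hence independent of \<open>R\<close>. Because \<open>n\<close> is not 0, its intersection
        with a true \<open>R\<close> is the event for \<open>N\<close>.\<close>
      have nB: "{n} \<times> B \<in> sets ?T" using B by (intro pair_measureI) auto
      have "indep_set {R -` A \<inter> space M | A. A \<in> sets (count_space UNIV)} {?Z -` B \<inter> space M | B. B \<in> sets ?T}"
        using assms(20)[OF n] by (simp add: indep_rvs_def)
      moreover have "R -` {True} \<inter> space M \<in> {R -` A \<inter> space M | A. A \<in> sets (count_space UNIV)}" by auto
      moreover have "?Z -` ({n} \<times> B) \<inter> space M \<in> {?Z -` B \<inter> space M | B. B \<in> sets ?T}"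
        by (intro CollectI exI[of _ "{n} \<times> B"] conjI refl nB)
      ultimately have "prob ((R -` {True} \<inter> space M) \<inter> (?Z -` ({n} \<times> B) \<inter> space M))
          = prob (R -` {True} \<inter> space M) * prob (?Z -` ({n} \<times> B) \<inter> space M)"
        by (rule indep_setD)
      moreover have "(R -` {True} \<inter> space M) \<inter> (?Z -` ({n} \<times> B) \<inter> space M)
          = {\<omega> \<in> space M. N \<omega> = n \<and> (\<lambda>i\<in>{..<n}. Y i \<omega>) \<in> B}"
      proof (rule Set.set_eqI)
        fix \<omega>
        show "\<omega> \<in> (R -` {True} \<inter> space M) \<inter> (?Z -` ({n} \<times> B) \<inter> space M)
          \<longleftrightarrow> \<omega> \<in> {\<omega> \<in> space M. N \<omega> = n \<and> (\<lambda>i\<in>{..<n}. Y i \<omega>) \<in> B}"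
          by (cases "\<omega> \<in> space M"; cases "R \<omega>") (use assms(21)[of \<omega>] n in simp_all)
      qed
      moreover have "?Z -` ({n} \<times> B) \<inter> space M = ?E" by auto
      moreover have "R -` {True} \<inter> space M = {\<omega> \<in> space M. R \<omega> = True}" by auto
      ultimately have "prob {\<omega> \<in> space M. N \<omega> = n \<and> (\<lambda>i\<in>{..<n}. Y i \<omega>) \<in> B} = p * prob ?E"
        using R_prob[of True] assms(16,17) by simp
      then have "emeasure M {\<omega> \<in> space M. N \<omega> = n \<and> (\<lambda>i\<in>{..<n}. Y i \<omega>) \<in> B} = ennreal p * emeasure M ?E"
        using assms(16) by (simp add: emeasure_eq_measure ennreal_mult)
      also have "emeasure M ?E = (\<integral>\<^sup>+t\<in>B. indicator (open_unit_cube n) (\<lambda>i\<in>{..<n}. F2 (t i)) * ennreal (c n (\<lambda>i\<in>{..<n}. F2 (t i)))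
          * (\<Prod>i<n. ennreal (f2 (t i))) * ennreal (\<delta> t) \<partial>lborel_pow n)"
        unfolding \<delta>_def
        by (rule emeasure_claim_count_severities[OF assms(1) n pdS pdJ N F1 assms(12) Y assms(14)[OF n] c B])
      also have "ennreal p * \<dots> = (\<integral>\<^sup>+ y \<in> B. ennreal (?h n y) \<partial>lborel_pow n)"
        unfolding hW mult.assoc[of "ennreal p"]
      proof (rule nn_integral_cmult[symmetric])
        have "B \<in> sets (lborel_pow n)" using B by (simp add: sets_lborel_pow)
        then show "(\<lambda>t. indicator (open_unit_cube n) (\<lambda>i\<in>{..<n}. F2 (t i)) * ennreal (c n (\<lambda>i\<in>{..<n}. F2 (t i)))
          * (\<Prod>i<n. ennreal (f2 (t i))) * ennreal (\<delta> t) * indicator B t) \<in> borel_measurable (lborel_pow n)"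
          using measurable_compose[OF FY borel_measurable_copula_density[OF c]] \<delta>m by measurable
      qed
      finally show ?thesis .
    qed
    then show ?thesis using hm h0 by blast
  qed
  with zero show ?thesis unfolding is_joint_density_def by blast
qed

end
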